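(* Let $(X,d)$ be a compact metric space and let $f:X\to X$ be a continuous map such that (1) $f$ has the limit shadowing property, and (2) $h_{top}(f)>0$. Then $f$ exhibits distributional chaos of type 1 (DC1). Moreover, $E(X,f)\subset\overline{DC1(X,f)}$, where the closure is taken in $X^2$.
   Context: A sequence $(x_i)_{i\ge0}$ in $X$ is a limit pseudo orbit of $f$ if $\lim_{i\to\infty}d(f(x_i),x_{i+1})=0$; $f$ has the limit shadowing property if for every limit pseudo orbit $(x_i)_{i\ge0}$ there is $x\in X$ with $\lim_{i\to\infty}d(f^i(x),x_i)=0$. $h_{top}(f)$ is the topological entropy. For an open cover $\mathcal U$, $h(f,\mathcal U)$ is the entropy of $f$ relative to $\mathcal U$. A pair $(x,y)\in X^2$ with $x\ne y$ is an entropy pair if for all closed neighborhoods $A$ of $x$ and $B$ of $y$ with $A\cap B=\emptyset$, $h(f,\{X\setminus A,X\setminus B\})>0$; $E(X,f)$ is the set of entropy pairs. A pair $(x,y)\in X^2$ is a DC1-pair for $f$ if $\limsup_{n\to\infty}\frac1n|\{0\le i\le n-1: d(f^i(x),f^i(y))<\delta\}|=1$ for every $\delta>0$, and $\limsup_{n\to\infty}\frac1n|\{0\le i\le n-1: d(f^i(x),f^i(y))>\delta_0\}|=1$ for some $\delta_0>0$; $DC1(X,f)$ is the set of DC1-pairs. $f$ exhibits DC1 if there is an uncountable $S\subset X$ such that every $(x,y)$ with $x,y\in S$, $x\neq y$, is a DC1-pair. *)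

theory Defs
  imports "HOL-Analysis.Analysis"
begin

definition limit_pseudo_orbit :: "'a::metric_space set \<Rightarrow> ('a \<Rightarrow> 'a) \<Rightarrow> (nat \<Rightarrow> 'a) \<Rightarrow> bool" where
  "limit_pseudo_orbit X f x \<longleftrightarrow>
     (\<forall>i. x i \<in> X) \<and> (\<lambda>i. dist (f (x i)) (x (Suc i))) \<longlonglongrightarrow> 0"

definition limit_shadowing :: "'a::metric_space set \<Rightarrow> ('a \<Rightarrow> 'a) \<Rightarrow> bool" where
  "limit_shadowing X f \<longleftrightarrow>
     (\<forall>x. limit_pseudo_orbit X f x \<longrightarrow>
        (\<exists>y\<in>X. (\<lambda>i. dist ((f ^^ i) y) (x i)) \<longlonglongrightarrow> 0))"

definition open_cover :: "'a::topological_space set \<Rightarrow> 'a set set \<Rightarrow> bool" where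
  "open_cover X U \<longleftrightarrow> (\<forall>V\<in>U. openin (top_of_set X) V) \<and> X \<subseteq> \<Union>U"

definition cover_num :: "'a set \<Rightarrow> 'a set set \<Rightarrow> nat" where
  "cover_num X U = (LEAST n. \<exists>D\<subseteq>U. finite D \<and> card D = n \<and> X \<subseteq> \<Union>D)"

definition cover_join :: "'a set \<Rightarrow> ('a \<Rightarrow> 'a) \<Rightarrow> 'a set set \<Rightarrow> nat \<Rightarrow> 'a set set" where
  "cover_join X f U n =
     {X \<inter> (\<Inter>i\<in>{..<n}. (f ^^ i) -` g i) | g. \<forall>i<n. g i \<in> U}"

definition cover_entropy :: "'a set \<Rightarrow> ('a \<Rightarrow> 'a) \<Rightarrow> 'a set set \<Rightarrow> real" where
  "cover_entropy X f U = lim (\<lambda>n. ln (real (cover_num X (cover_join X f U n))) / real n)"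

definition top_entropy :: "'a::topological_space set \<Rightarrow> ('a \<Rightarrow> 'a) \<Rightarrow> ereal" where
  "top_entropy X f = (SUP U\<in>{U. open_cover X U}. ereal (cover_entropy X f U))"

definition closed_nbhd :: "'a::topological_space set \<Rightarrow> 'a set \<Rightarrow> 'a \<Rightarrow> bool" where
  "closed_nbhd X A x \<longleftrightarrow> closedin (top_of_set X) A \<and>
     (\<exists>V. openin (top_of_set X) V \<and> x \<in> V \<and> V \<subseteq> A)"

definition entropy_pairs :: "'a::topological_space set \<Rightarrow> ('a \<Rightarrow> 'a) \<Rightarrow> ('a \<times> 'a) set" where
  "entropy_pairs X f = {(x, y). x \<in> X \<and> y \<in> X \<and> x \<noteq> y \<and>
     (\<forall>A B. closed_nbhd X A x \<longrightarrow> closed_nbhd X B y \<longrightarrow> A \<inter> B = {} \<longrightarrow>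
        cover_entropy X f {X - A, X - B} > 0)}"

definition DC1_pair :: "'a::metric_space set \<Rightarrow> ('a \<Rightarrow> 'a) \<Rightarrow> 'a \<Rightarrow> 'a \<Rightarrow> bool" where
  "DC1_pair X f x y \<longleftrightarrow> x \<in> X \<and> y \<in> X \<and>
     (\<forall>\<delta>>0. limsup (\<lambda>n. ereal (real (card {i. i < n \<and> dist ((f ^^ i) x) ((f ^^ i) y) < \<delta>}) / real n)) = 1) \<and>
     (\<exists>\<delta>0>0. limsup (\<lambda>n. ereal (real (card {i. i < n \<and> dist ((f ^^ i) x) ((f ^^ i) y) > \<delta>0}) / real n)) = 1)"

definition DC1_pairs :: "'a::metric_space set \<Rightarrow> ('a \<Rightarrow> 'a) \<Rightarrow> ('a \<times> 'a) set" where
  "DC1_pairs X f = {(x, y). DC1_pair X f x y}"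

definition exhibits_DC1 :: "'a::metric_space set \<Rightarrow> ('a \<Rightarrow> 'a) \<Rightarrow> bool" where
  "exhibits_DC1 X f \<longleftrightarrow> (\<exists>S\<subseteq>X. uncountable S \<and>
     (\<forall>x\<in>S. \<forall>y\<in>S. x \<noteq> y \<longrightarrow> DC1_pair X f x y))"

end

theory Submission
  imports Defs
begin


text \<open>Zorn's lemma gives a closed invariant set \<open>K\<close>, minimal among those whose numbers of itineraries
  grow at a fixed exponential rate. Minimality makes \<open>K\<close> internally chain transitive, and counting
  itineraries yields two distinct points \<open>u\<close>, \<open>v\<close> of \<open>K\<close> (near the two points of a given entropy
  pair) such that, for every \<open>\<delta>\<close>, all four \<open>\<delta>\<close>-chains between them can be chosen of the same length
  \<open>N\<close>. Hence every sequence of symbols \<open>u\<close>, \<open>v\<close> is followed with period \<open>N\<close> by a true orbit, as limit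
  shadowing implies a uniform shadowing of finite chains in \<open>K\<close>. Following the coding of an irrational
  rotation and passing to a limit point gives a recurrent point \<open>a\<close> which, for suitable \<open>p\<close> divisible
  by any prescribed number, stays uniformly far from its \<open>p\<close>-th iterate. Two kinds of chain blocks of
  equal length from \<open>a\<close> to \<open>a\<close>, which agree for a very long time and then stay apart for a very long
  time, are concatenated along binary sequences; limit shadowing turns the resulting limit pseudo
  orbits into an uncountable set of points any two of which form a DC1 pair.\<close>

section \<open>Counting itineraries\<close>

text \<open>A chain from \<open>u\<close> to \<open>u\<close> and one from \<open>v\<close> to
  \<open>v\<close> need not stay apart between their end points, and chains with smaller jumps have
  other lengths. So the blocks that must stay apart are not built from these chains. The precision,
  and with it \<open>N\<close>, is fixed once, and a true orbit follows the code at that precision.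
  Its separation near multiples of \<open>N\<close> spreads to all times by uniform continuity of
  the first \<open>2 * N\<close> iterates, and segments of a true orbit are chains for every size of
  jump, however small. The loops at \<open>a\<close> that make the lengths agree change with the
  size of jump, which is why \<open>p\<close> has to be available as a multiple of any given number;
  a periodic code would repeat itself, and not alternate, at multiples of its period. Limit
  shadowing says nothing about early times, so the DC1 pairs close to \<open>(u, v)\<close> are
  iterates of coded points, taken at a late time when the pseudo orbits pass near \<open>u\<close>
  and \<open>v\<close>.\<close>

lemma cover_num_le:
  assumes "D \<subseteq> U" "finite D" "K \<subseteq> \<Union>D"
  shows "cover_num K U \<le> card D"
  unfolding cover_num_def by (rule Least_le) (use assms in blast)

lemma cover_num_witness:
  assumes "D \<subseteq> U" "finite D" "K \<subseteq> \<Union>D"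
  obtains E where "E \<subseteq> U" "finite E" "card E = cover_num K U" "K \<subseteq> \<Union>E"
proof -
  have "\<exists>n. \<exists>D\<subseteq>U. finite D \<and> card D = n \<and> K \<subseteq> \<Union>D"
    using assms by blast
  from LeastI_ex[OF this] show ?thesis
    using that unfolding cover_num_def by blast
qed

text \<open>Finite intersection property for the sets \<open>K - W\<close>: finitely many members of
  a chain have a least one among them, so if no \<open>K - W\<close> were empty, the intersection of
  \<open>F\<close> would have a point outside \<open>W\<close>.\<close>

lemma chain_subset_open:
  fixes F :: "'a::metric_space set set"
  assumes "F \<noteq> {}" and cpt: "\<And>K. K \<in> F \<Longrightarrow> compact K"
    and chain: "\<And>K L. K \<in> F \<Longrightarrow> L \<in> F \<Longrightarrow> K \<subseteq> L \<or> L \<subseteq> K"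
    and "open W" "\<Inter>F \<subseteq> W"
  shows "\<exists>K\<in>F. K \<subseteq> W"
proof (rule ccontr)
  assume "\<not> ?thesis"
  then have ne: "{} \<notin> (\<lambda>K. K - W) ` F"
    by auto
  obtain K0 where "K0 \<in> F" using \<open>F \<noteq> {}\<close> by blast
  have "K0 \<inter> \<Inter>((\<lambda>K. K - W) ` F) \<noteq> {}"
  proof (rule compact_imp_fip)
    show "compact K0" using cpt \<open>K0 \<in> F\<close> by blast
    show "closed T" if "T \<in> (\<lambda>K. K - W) ` F" for T
      using that cpt \<open>open W\<close> by (auto intro!: compact_imp_closed compact_diff)
    show "K0 \<inter> \<Inter>G \<noteq> {}" if G: "finite G" "G \<subseteq> (\<lambda>K. K - W) ` F" for G
    proof -
      obtain H where H: "finite H" "H \<subseteq> F" "G = (\<lambda>K. K - W) ` H"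
        using finite_subset_image[OF G] by blast
      have "\<exists>L\<in>insert K0 F. \<forall>K\<in>insert K0 H. L \<subseteq> K"
        using H(1,2)
      proof (induction H rule: finite_induct)
        case empty
        then show ?case by blast
      next
        case (insert x H)
        then obtain L where L: "L \<in> insert K0 F" "\<forall>K\<in>insert K0 H. L \<subseteq> K"
          by blast
        have "x \<in> F" using insert.prems by blast
        then have "x \<subseteq> L \<or> L \<subseteq> x"
          using chain L(1) \<open>K0 \<in> F\<close> by blast
        then show ?case
        proof
          assume "x \<subseteq> L"
          then show ?thesis using L \<open>x \<in> F\<close> by (intro bexI[of _ x]) auto
        next
          assume "L \<subseteq> x"
          then show ?thesis using L by (intro bexI[of _ L]) auto
        qed
      qed
      then obtain L where L: "L \<in> F" "\<forall>K\<in>insert K0 H. L \<subseteq> K"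
        using \<open>K0 \<in> F\<close> by blast
      then have "L - W \<noteq> {}" using ne by blast
      moreover have "L - W \<subseteq> K0 \<inter> \<Inter>G" using L H by blast
      ultimately show ?thesis by blast
    qed
  qed
  then show False using \<open>\<Inter>F \<subseteq> W\<close> \<open>K0 \<in> F\<close> by blast
qed

text \<open>Failure of a bound at the single time \<open>m\<close> leaves room for a rate strictly
  below \<open>a\<close>; this gap later absorbs a linear factor.\<close>

lemma exp_rate_obtain:
  fixes N :: nat
  assumes "a > 0" "m \<ge> 1" "real N < exp (a * real m)"
  obtains b where "0 \<le> b" "b < a" "real N \<le> exp (b * real m)"
proof
  \<comment> \<open>The maximum handles \<open>N = 0\<close> and keeps \<open>b\<close>
    nonnegative.\<close>
  define b where "b = ln (max 1 (real N)) / real m"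
  show "0 \<le> b" by (simp add: b_def)
  have m: "real m > 0" using \<open>m \<ge> 1\<close> by simp
  have "max 1 (real N) < exp (a * real m)"
    using assms m by simp
  then have "ln (max 1 (real N)) < ln (exp (a * real m))"
    by (subst ln_less_cancel_iff) auto
  then have "ln (max 1 (real N)) < a * real m" by simp
  then show "b < a" using m by (simp add: b_def divide_simps)
  have "exp (b * real m) = max 1 (real N)" using m by (simp add: b_def)
  then show "real N \<le> exp (b * real m)" by simp
qed

text \<open>The linear factor will count first entrance times; the quadratic term of the exponential
  series outgrows it.\<close>

lemma linear_times_exp_less_exp:
  fixes a b C :: real
  assumes "b < a"
  obtains n :: nat where "C * (real n + 1) * exp (b * real n) < exp (a * real n)"
proof -
  define d where "d = a - b"
  have d: "d > 0" using assms by (simp add: d_def)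
  \<comment> \<open>The first bound gives \<open>n + 1 \<le> 2 n\<close>, the second makes
    \<open>2 |C| n\<close> smaller than half the square of \<open>d n\<close>.\<close>
  obtain n :: nat where n: "real n > max 1 (4 * \<bar>C\<bar> / d^2)"
    using reals_Archimedean2 by blast
  have n1: "real n > 1" "4 * \<bar>C\<bar> < d^2 * real n"
    using n d by (auto simp: divide_simps mult.commute)
  have "C * (real n + 1) \<le> \<bar>C\<bar> * (2 * real n)"
    using n1 by (intro mult_mono) auto
  also have "\<dots> < (d * real n)^2 / 2"
  proof -
    have "(4 * \<bar>C\<bar>) * real n < (d^2 * real n) * real n"
      using n1 by (intro mult_strict_right_mono) auto
    then show ?thesis by (simp add: power2_eq_square algebra_simps)
  qed
  also have "\<dots> \<le> exp (d * real n)"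
  proof -
    have "0 \<le> d * real n" using d by simp
    then show ?thesis using exp_lower_Taylor_quadratic[of "d * real n"] by linarith
  qed
  finally have "C * (real n + 1) < exp (d * real n)" .
  then have "C * (real n + 1) * exp (b * real n) < exp (d * real n) * exp (b * real n)"
    by simp
  also have "\<dots> = exp (a * real n)"
    by (simp add: d_def flip: exp_add) (simp add: algebra_simps)
  finally show ?thesis by (rule that)
qed

section \<open>Iterates of a continuous self-map of a compact set\<close>

locale compact_system =
  fixes X :: "'a::metric_space set" and f :: "'a \<Rightarrow> 'a"
  assumes compact_X: "compact X" and cont_f: "continuous_on X f" and image_f: "f ` X \<subseteq> X"
begin

lemma funpow_mem: "x \<in> K \<Longrightarrow> f ` K \<subseteq> K \<Longrightarrow> (f ^^ n) x \<in> K"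
  by (induction n) auto

lemma funpow_in_X: "x \<in> X \<Longrightarrow> (f ^^ n) x \<in> X"
  using funpow_mem image_f by blast

lemma cont_funpow: "continuous_on X (f ^^ n)"
proof (induction n)
  case (Suc n)
  have "continuous_on ((f ^^ n) ` X) f"
    using cont_f by (rule continuous_on_subset) (auto simp: funpow_in_X)
  from continuous_on_compose[OF Suc this] show ?case by (simp add: o_def)
qed (simp add: id_def)

lemma compact_vimage:
  assumes "K \<subseteq> X" "compact K" "closed T"
  shows "compact {x \<in> K. (f ^^ n) x \<in> T}"
proof -
  have "closedin (top_of_set K) {x \<in> K. (f ^^ n) x \<in> T}"
    using continuous_closedin_preimage[OF continuous_on_subset[OF cont_funpow \<open>K \<subseteq> X\<close>] \<open>closed T\<close>]
    by (simp add: vimage_def Int_def)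
  then show ?thesis using \<open>compact K\<close> closedin_compact by blast
qed

end

section \<open>Itineraries with respect to a fixed cover\<close>

locale covered_system = compact_system X f
  for X :: "'a::metric_space set" and f :: "'a \<Rightarrow> 'a" +
  fixes U :: "'a set set"
  assumes open_cover_U: "open_cover X U"
begin

abbreviation join :: "nat \<Rightarrow> 'a set set" where "join \<equiv> cover_join X f U"

text \<open>All subsets are measured with the same cover of \<open>X\<close>, so that counts for
  different sets can be compared, added and multiplied. For \<open>n = 0\<close> the join is
  \<open>{X}\<close>: a nonempty subset of \<open>X\<close> has count 1, the empty set 0.\<close>

definition itin_num :: "'a set \<Rightarrow> nat \<Rightarrow> nat" where
  "itin_num K n = cover_num K (join n)"

lemma openin_join:
  assumes "V \<in> join n" shows "openin (top_of_set X) V"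
proof -
  obtain g where g: "V = X \<inter> (\<Inter>i\<in>{..<n}. (f ^^ i) -` g i)" "\<forall>i<n. g i \<in> U"
    using assms unfolding cover_join_def by blast
  have op: "openin (top_of_set X) (X \<inter> (f ^^ i) -` g i)" if "i < n" for i
  proof (rule continuous_openin_preimage[OF cont_funpow])
    show "openin (top_of_set X) (g i)" using g that open_cover_U by (auto simp: open_cover_def)
  qed (use funpow_in_X in auto)
  show ?thesis
  proof (cases "n = 0")
    case False
    have "V = (\<Inter>i\<in>{..<n}. X \<inter> (f ^^ i) -` g i)"
      using g False by auto
    moreover have "openin (top_of_set X) (\<Inter>((\<lambda>i. X \<inter> (f ^^ i) -` g i) ` {..<n}))"
      using op False by (intro openin_Inter) auto
    ultimately show ?thesis by simp
  qed (use g in auto)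
qed

lemma join_covers: "X \<subseteq> \<Union>(join n)"
proof
  fix x assume "x \<in> X"
  have "X \<subseteq> \<Union>U" using open_cover_U by (simp add: open_cover_def)
  then have "\<forall>i. \<exists>V\<in>U. (f ^^ i) x \<in> V"
    using funpow_in_X[OF \<open>x \<in> X\<close>] by blast
  then obtain g where "\<forall>i. g i \<in> U \<and> (f ^^ i) x \<in> g i" by metis
  then show "x \<in> \<Union>(join n)"
    using \<open>x \<in> X\<close> unfolding cover_join_def
    by (auto intro!: exI[of _ "X \<inter> (\<Inter>i\<in>{..<n}. (f ^^ i) -` g i)"])
qed

lemma itin_num_le:
  assumes "D \<subseteq> join n" "finite D" "K \<subseteq> \<Union>D"
  shows "itin_num K n \<le> card D"
  using assms unfolding itin_num_def by (rule cover_num_le)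

lemma itin_num_witness:
  assumes "K \<subseteq> X"
  obtains D where "D \<subseteq> join n" "finite D" "card D = itin_num K n" "K \<subseteq> \<Union>D"
proof -
  obtain D where D: "D \<subseteq> join n" "finite D" "X \<subseteq> \<Union>D"
    using compact_X openin_join join_covers unfolding compact_eq_openin_cover by metis
  obtain E where "E \<subseteq> join n" "finite E" "card E = cover_num K (join n)" "K \<subseteq> \<Union>E"
    using cover_num_witness[OF D(1,2) order_trans[OF assms D(3)]] .
  then show ?thesis by (intro that) (simp_all add: itin_num_def)
qed

lemma itin_num_mono: "K \<subseteq> L \<Longrightarrow> L \<subseteq> X \<Longrightarrow> itin_num K n \<le> itin_num L n"
  by (rule itin_num_witness[of L n]) (use itin_num_le order_trans in metis)+

lemma itin_num_Un:
  assumes "K \<subseteq> X" "L \<subseteq> X"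
  shows "itin_num (K \<union> L) n \<le> itin_num K n + itin_num L n"
proof -
  obtain D where D: "D \<subseteq> join n" "finite D" "card D = itin_num K n" "K \<subseteq> \<Union>D"
    using itin_num_witness assms by metis
  obtain E where E: "E \<subseteq> join n" "finite E" "card E = itin_num L n" "L \<subseteq> \<Union>E"
    using itin_num_witness assms by metis
  have "itin_num (K \<union> L) n \<le> card (D \<union> E)"
    using D E by (intro itin_num_le) auto
  also have "\<dots> \<le> card D + card E" by (rule card_Un_le)
  finally show ?thesis using D E by simp
qed

lemma itin_num_UN:
  assumes "finite I" "\<And>i. i \<in> I \<Longrightarrow> K i \<subseteq> X"
  shows "itin_num (\<Union>i\<in>I. K i) n \<le> (\<Sum>i\<in>I. itin_num (K i) n)"
  using assms
proof (induction I rule: finite_induct)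
  case empty
  then show ?case using itin_num_le[of "{}" n "{}"] by simp
next
  case (insert j I)
  have "itin_num (\<Union>i\<in>insert j I. K i) n \<le> itin_num (K j) n + itin_num (\<Union>i\<in>I. K i) n"
    using itin_num_Un[of "K j" "\<Union>i\<in>I. K i"] insert.prems by auto
  then show ?case using insert by fastforce
qed

text \<open>An itinerary of length \<open>m + n\<close> is one of length \<open>m\<close> followed
  by one, of length \<open>n\<close>, of the \<open>m\<close>-th image. A separate set
  \<open>L\<close> for that image lets the two factors grow at unrelated rates.\<close>

lemma itin_num_add:
  assumes "K \<subseteq> X" "L \<subseteq> X" "(f ^^ m) ` K \<subseteq> L"
  shows "itin_num K (m + n) \<le> itin_num K m * itin_num L n"
proof -
  obtain D where D: "D \<subseteq> join m" "finite D" "card D = itin_num K m" "K \<subseteq> \<Union>D"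
    using itin_num_witness assms by metis
  obtain E where E: "E \<subseteq> join n" "finite E" "card E = itin_num L n" "L \<subseteq> \<Union>E"
    using itin_num_witness assms by metis
  define F where "F = (\<lambda>(A, B). A \<inter> (f ^^ m) -` B) ` (D \<times> E)"
  have "itin_num K (m + n) \<le> card F"
  proof (rule itin_num_le)
    show "F \<subseteq> join (m + n)"
    proof
      fix W assume "W \<in> F"
      then obtain A B where W: "A \<in> join m" "B \<in> join n" "W = A \<inter> (f ^^ m) -` B"
        using D E unfolding F_def by blast
      obtain g where g: "A = X \<inter> (\<Inter>i\<in>{..<m}. (f ^^ i) -` g i)" "\<forall>i<m. g i \<in> U"
        using W(1) unfolding cover_join_def by blast
      obtain h where h: "B = X \<inter> (\<Inter>i\<in>{..<n}. (f ^^ i) -` h i)" "\<forall>i<n. h i \<in> U"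
        using W(2) unfolding cover_join_def by blast
      define k where "k i = (if i < m then g i else h (i - m))" for i
      have "x \<in> W \<longleftrightarrow> x \<in> X \<inter> (\<Inter>i\<in>{..<m + n}. (f ^^ i) -` k i)" for x
      proof -
        have "x \<in> W \<longleftrightarrow> x \<in> X \<and> (\<forall>i<m. (f ^^ i) x \<in> g i) \<and> (\<forall>i<n. (f ^^ (i + m)) x \<in> h i)"
          using W(3) g(1) h(1) funpow_in_X by (auto simp: funpow_add)
        also have "\<dots> \<longleftrightarrow> x \<in> X \<and> (\<forall>i<m + n. (f ^^ i) x \<in> k i)"
        proof (intro conj_cong refl iffI)
          assume l: "(\<forall>i<m. (f ^^ i) x \<in> g i) \<and> (\<forall>i<n. (f ^^ (i + m)) x \<in> h i)"
          show "\<forall>i<m + n. (f ^^ i) x \<in> k i"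
          proof (intro allI impI)
            fix i assume "i < m + n"
            then show "(f ^^ i) x \<in> k i"
              using l[THEN conjunct1, rule_format, of i] l[THEN conjunct2, rule_format, of "i - m"]
              by (cases "i < m") (auto simp: k_def)
          qed
        next
          assume r: "\<forall>i<m + n. (f ^^ i) x \<in> k i"
          show "(\<forall>i<m. (f ^^ i) x \<in> g i) \<and> (\<forall>i<n. (f ^^ (i + m)) x \<in> h i)"
            using r[rule_format] unfolding k_def
            by (metis add.commute add_diff_cancel_right' add_less_cancel_left not_add_less2 trans_less_add1)
        qed
        finally show ?thesis by auto
      qed
      then have "W = X \<inter> (\<Inter>i\<in>{..<m + n}. (f ^^ i) -` k i)" by blast
      moreover have "\<forall>i<m + n. k i \<in> U" using g h unfolding k_def by auto
      ultimately show "W \<in> join (m + n)" unfolding cover_join_def by blast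
    qed
    show "finite F" unfolding F_def using D E by auto
    show "K \<subseteq> \<Union>F"
    proof
      fix x assume "x \<in> K"
      then have "x \<in> \<Union>D" "(f ^^ m) x \<in> \<Union>E"
        using subsetD[OF D(4)] subsetD[OF E(4)] subsetD[OF assms(3)] by blast+
      then obtain A B where "A \<in> D" "x \<in> A" "B \<in> E" "(f ^^ m) x \<in> B" by blast
      then show "x \<in> \<Union>F" unfolding F_def by (intro UnionI[of "A \<inter> (f ^^ m) -` B"]) auto
    qed
  qed
  also have "\<dots> \<le> card (D \<times> E)" unfolding F_def using D E by (intro card_image_le) auto
  finally show ?thesis using D E by (simp add: card_cartesian_product)
qed

lemma itin_num_pos:
  assumes "K \<subseteq> X" "K \<noteq> {}" shows "itin_num K n \<ge> 1"
proof -
  obtain D where D: "D \<subseteq> join n" "finite D" "card D = itin_num K n" "K \<subseteq> \<Union>D"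
    using itin_num_witness assms by metis
  then have "D \<noteq> {}" using \<open>K \<noteq> {}\<close> by auto
  then show ?thesis using D by (metis One_nat_def Suc_leI card_gt_0_iff)
qed

text \<open>A smallest subcover of the intersection has a relatively open union, which by
  compactness already contains a member of the chain.\<close>

lemma itin_num_chain_Inter:
  assumes "F \<noteq> {}" and cpt: "\<And>K. K \<in> F \<Longrightarrow> compact K \<and> K \<subseteq> X"
    and chain: "\<And>K L. K \<in> F \<Longrightarrow> L \<in> F \<Longrightarrow> K \<subseteq> L \<or> L \<subseteq> K"
  obtains K where "K \<in> F" "itin_num K n \<le> itin_num (\<Inter>F) n"
proof -
  have "\<Inter>F \<subseteq> X" using assms by blast
  then obtain D where D: "D \<subseteq> join n" "finite D" "card D = itin_num (\<Inter>F) n" "\<Inter>F \<subseteq> \<Union>D"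
    using itin_num_witness by metis
  have "openin (top_of_set X) (\<Union>D)" using D openin_join by blast
  then obtain W where W: "open W" "\<Union>D = X \<inter> W"
    by (auto simp: openin_open)
  have "\<exists>K\<in>F. K \<subseteq> W"
  proof (rule chain_subset_open[OF \<open>F \<noteq> {}\<close>])
    show "\<Inter>F \<subseteq> W" using D W by blast
  qed (use cpt chain W in blast)+
  then obtain K where "K \<in> F" "K \<subseteq> W" by blast
  then have "K \<subseteq> \<Union>D" using W cpt by blast
  then show ?thesis using that \<open>K \<in> F\<close> itin_num_le D by metis
qed

end


section \<open>A minimal set carrying entropy\<close>

context covered_system
begin

text \<open>Cutting off \<open>m\<close> steps at a time costs a factor \<open>exp (b * m)\<close>
  each. A decreasing family is treated because the points that avoid a set up to time
  \<open>t\<close> need not form an invariant set.\<close>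

lemma itin_num_growth:
  fixes K :: "nat \<Rightarrow> 'a set"
  assumes "\<And>t. K t \<subseteq> X" and anti: "\<And>s t. s \<le> t \<Longrightarrow> K t \<subseteq> K s"
    and shift: "\<And>t. (f ^^ m) ` K (t + m) \<subseteq> K t"
    and "m \<ge> 1" "0 \<le> b" and le: "real (itin_num (K s) m) \<le> exp (b * real m)"
  obtains C where "C \<ge> 1" "\<And>t. real (itin_num (K t) t) \<le> C * exp (b * real t)"
proof -
  \<comment> \<open>The constant absorbs all \<open>t < s + m\<close>; from then on
    \<open>K t\<close> lies in \<open>K s\<close>, where the assumed bound applies.\<close>
  define C where "C = 1 + (\<Sum>t<s + m. real (itin_num (K t) t))"
  have "C \<ge> 1" by (simp add: C_def sum_nonneg)
  have "real (itin_num (K t) t) \<le> C * exp (b * real t)" for t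
  proof (induction t rule: less_induct)
    case (less t)
    show ?case
    proof (cases "t < s + m")
      case True
      have "real (itin_num (K t) t) \<le> (\<Sum>t<s + m. real (itin_num (K t) t))"
        using True by (intro member_le_sum) auto
      also have "\<dots> \<le> C * 1" by (simp add: C_def)
      also have "\<dots> \<le> C * exp (b * real t)"
        using \<open>C \<ge> 1\<close> \<open>0 \<le> b\<close> by (intro mult_left_mono) auto
      finally show ?thesis .
    next
      case False
      define r where "r = t - m"
      have t: "t = m + r" using False by (simp add: r_def)
      have "itin_num (K t) t \<le> itin_num (K t) m * itin_num (K r) r"
        unfolding t using assms(1) shift[of r] by (intro itin_num_add) (auto simp: add.commute)
      then have "real (itin_num (K t) t) \<le> real (itin_num (K t) m) * real (itin_num (K r) r)"
        by (metis of_nat_le_iff of_nat_mult)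
      also have "\<dots> \<le> exp (b * real m) * (C * exp (b * real r))"
      proof (intro mult_mono)
        have "itin_num (K t) m \<le> itin_num (K s) m"
          using anti[of s t] False assms(1) by (intro itin_num_mono) auto
        then show "real (itin_num (K t) m) \<le> exp (b * real m)" using le by linarith
        show "real (itin_num (K r) r) \<le> C * exp (b * real r)"
          using less[of r] \<open>m \<ge> 1\<close> t by auto
      qed auto
      also have "\<dots> = C * exp (b * real t)"
        by (simp add: t exp_add algebra_simps)
      finally show ?thesis .
    qed
  qed
  with \<open>C \<ge> 1\<close> show ?thesis using that by blast
qed

text \<open>\<open>cover_entropy\<close> is a \<open>lim\<close>, so its value says something only
  through convergence. If every rate \<open>a > 0\<close> failed at some \<open>m\<close>, the
  growth bound would make the sequence actually converge to 0, against the assumption.\<close>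

lemma itin_num_ge_exp:
  assumes "cover_entropy X f U > 0"
  shows "\<exists>a>0. \<forall>n. exp (a * real n) \<le> real (itin_num X n)"
proof (rule ccontr)
  assume "\<not> ?thesis"
  then have ex: "\<exists>m. real (itin_num X m) < exp (a * real m)" if "a > 0" for a
    using that by (meson not_less)
  define u where "u n = ln (real (itin_num X n)) / real n" for n
  have "u \<longlonglongrightarrow> 0"
  proof (cases "X = {}")
    \<comment> \<open>All counts vanish here, and \<open>ln 0 = 0\<close>.\<close>
    case True
    have "itin_num X n = 0" for n
      using itin_num_le[of "{}" n X] True by simp
    then show ?thesis by (simp add: u_def[abs_def])
  next
    case False
    have ge1: "real (itin_num X n) \<ge> 1" for n
      using itin_num_pos[of X n] False by simp
    have u0: "u n \<ge> 0" for n
      using ge1[of n] by (simp add: u_def)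
    show ?thesis
    proof (rule LIMSEQ_I)
      fix e :: real assume "0 < e"
      obtain m where m: "real (itin_num X m) < exp (e / 2 * real m)"
        using ex[of "e / 2"] \<open>0 < e\<close> by auto
      have "m \<ge> 1"
      proof (rule ccontr)
        assume "\<not> m \<ge> 1"
        then have "m = 0" by simp
        then show False using m ge1[of 0] by simp
      qed
      obtain b where b: "0 \<le> b" "b < e / 2" "real (itin_num X m) \<le> exp (b * real m)"
        using exp_rate_obtain[OF _ \<open>m \<ge> 1\<close> m] \<open>0 < e\<close> by auto
      obtain C where C: "C \<ge> 1" "\<And>t. real (itin_num X t) \<le> C * exp (b * real t)"
      proof (rule itin_num_growth[of "\<lambda>_. X" m b 0])
        show "(f ^^ m) ` X \<subseteq> X" using funpow_in_X by blast
      qed (use b \<open>m \<ge> 1\<close> in auto)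
      \<comment> \<open>Beyond \<open>n0\<close> the constant \<open>C\<close> contributes less than
        \<open>e / 2\<close> to the rate.\<close>
      obtain n0 :: nat where n0: "real n0 > max 1 (2 * ln C / e)"
        using reals_Archimedean2 by blast
      have "norm (u n - 0) < e" if "n \<ge> n0" for n
      proof -
        have n: "real n > 1" "real n > 2 * ln C / e" using that n0 by auto
        have "ln (real (itin_num X n)) \<le> ln (C * exp (b * real n))"
          using C(2)[of n] ge1[of n] by (intro ln_mono) auto
        also have "\<dots> = ln C + b * real n"
          using C(1) by (simp add: ln_mult)
        also have "\<dots> < e / 2 * real n + b * real n"
          using n(2) \<open>0 < e\<close> by (simp add: divide_simps mult.commute)
        also have "\<dots> \<le> e / 2 * real n + e / 2 * real n"
          using b(2) n(1) by (intro add_left_mono mult_right_mono) auto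
        finally have "ln (real (itin_num X n)) < e * real n" by simp
        then have "u n < e" using n(1) by (simp add: u_def divide_simps)
        then show ?thesis using u0[of n] by simp
      qed
      then show "\<exists>n0. \<forall>n\<ge>n0. norm (u n - 0) < e" by blast
    qed
  qed
  then have "lim u = 0" by (rule limI)
  then show False using assms unfolding cover_entropy_def u_def[abs_def] itin_num_def by simp
qed

text \<open>One rate \<open>a\<close> is demanded at every \<open>n\<close>, because this form
  passes to intersections of chains, which mere positivity of the rate would not. The case
  \<open>n = 0\<close> excludes the empty set.\<close>

definition carries :: "real \<Rightarrow> 'a set \<Rightarrow> bool" where
  "carries a K \<longleftrightarrow> K \<subseteq> X \<and> compact K \<and> f ` K \<subseteq> K \<and>
     (\<forall>n. exp (a * real n) \<le> real (itin_num K n))"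

definition minimal_carrier :: "real \<Rightarrow> 'a set \<Rightarrow> bool" where
  "minimal_carrier a K \<longleftrightarrow> carries a K \<and> (\<forall>L\<subseteq>K. carries a L \<longrightarrow> L = K)"

lemma carries_chain_Inter:
  assumes "F \<noteq> {}" and car: "\<And>K. K \<in> F \<Longrightarrow> carries a K"
    and chain: "\<And>K L. K \<in> F \<Longrightarrow> L \<in> F \<Longrightarrow> K \<subseteq> L \<or> L \<subseteq> K"
  shows "carries a (\<Inter>F)"
  unfolding carries_def
proof (intro conjI allI)
  obtain K0 where K0: "K0 \<in> F" using \<open>F \<noteq> {}\<close> by blast
  have car': "K \<subseteq> X" "compact K" "f ` K \<subseteq> K" "exp (a * real n) \<le> real (itin_num K n)"
    if "K \<in> F" for K n
    using car[OF that] by (auto simp: carries_def)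
  show "\<Inter>F \<subseteq> X" using K0 car'(1) by blast
  have "closed (\<Inter>F)" using car'(2) compact_imp_closed by blast
  then have "compact (K0 \<inter> \<Inter>F)" using K0 car'(2) by (intro compact_Int_closed)
  moreover have "K0 \<inter> \<Inter>F = \<Inter>F" using K0 by blast
  ultimately show "compact (\<Inter>F)" by simp
  show "f ` \<Inter>F \<subseteq> \<Inter>F" using car'(3) by blast
  fix n
  obtain K where "K \<in> F" "itin_num K n \<le> itin_num (\<Inter>F) n"
    by (rule itin_num_chain_Inter[of F]) (use assms car' in blast)+
  then show "exp (a * real n) \<le> real (itin_num (\<Inter>F) n)"
    using car'(4)[of K n] by linarith
qed

lemma minimal_carrier_exists:
  assumes "\<And>n. exp (a * real n) \<le> real (itin_num X n)"
  obtains K where "minimal_carrier a K"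
proof -
  \<comment> \<open>Zorn's lemma is used in its maximal form, hence the complements.\<close>
  define A where "A = {X - K |K. carries a K}"
  have "carries a X"
    using assms compact_X image_f by (simp add: carries_def)
  have "\<exists>M\<in>A. \<forall>Y\<in>A. M \<subseteq> Y \<longrightarrow> Y = M"
  proof (rule subset_Zorn_nonempty)
    show "A \<noteq> {}" using \<open>carries a X\<close> by (auto simp: A_def)
    fix C assume C: "C \<noteq> {}" "subset.chain A C"
    define F where "F = (\<lambda>Y. X - Y) ` C"
    have sub: "Y \<subseteq> X" "carries a (X - Y)" if "Y \<in> C" for Y
    proof -
      have "Y \<in> A" using C(2) that by (auto simp: subset.chain_def)
      then obtain K where K: "Y = X - K" "carries a K" by (auto simp: A_def)
      then show "Y \<subseteq> X" by blast
      have "X - Y = K" using K by (auto simp: carries_def)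
      then show "carries a (X - Y)" using K by simp
    qed
    have "carries a (\<Inter>F)"
    proof (rule carries_chain_Inter)
      show "F \<noteq> {}" using C by (simp add: F_def)
      show "carries a K" if "K \<in> F" for K using that sub by (auto simp: F_def)
      show "K \<subseteq> L \<or> L \<subseteq> K" if KL: "K \<in> F" "L \<in> F" for K L
      proof -
        obtain Y1 Y2 where Y: "Y1 \<in> C" "Y2 \<in> C" "K = X - Y1" "L = X - Y2"
          using KL by (auto simp: F_def)
        then have "Y1 \<subseteq> Y2 \<or> Y2 \<subseteq> Y1" using C(2) unfolding subset_chain_def by blast
        then show ?thesis using Y by blast
      qed
    qed
    moreover have "\<Union>C = X - \<Inter>F"
      using sub(1) by (auto simp: F_def)
    ultimately show "\<Union>C \<in> A" by (auto simp: A_def)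
  qed
  then obtain K where K: "carries a K" "\<forall>Y\<in>A. X - K \<subseteq> Y \<longrightarrow> Y = X - K"
    by (auto simp: A_def)
  have "L = K" if L: "L \<subseteq> K" "carries a L" for L
  proof -
    have "X - L \<in> A" using L by (auto simp: A_def)
    then have "X - L = X - K" using K(2) L(1) by (metis Diff_mono order_refl)
    then show ?thesis using L K(1) by (auto simp: carries_def)
  qed
  then show ?thesis using that K(1) by (auto simp: minimal_carrier_def)
qed

text \<open>Were the trapped part \<open>Q\<close> proper, then both \<open>Q\<close> and the points that never enter \<open>V\<close> would
  have growth rate below \<open>a\<close>; splitting \<open>K\<close> by the first entrance time into \<open>V\<close> would bound its
  growth by the product of these rates.\<close>

lemma minimal_carrier_trapping:
  assumes "minimal_carrier a K" "a > 0"
    and "compact Q" "Q \<subseteq> K" "Q \<noteq> {}" "openin (top_of_set K) V" "f ` Q \<subseteq> V" "V \<subseteq> Q"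
  shows "Q = K"
proof (rule ccontr)
  assume "Q \<noteq> K"
  have K: "K \<subseteq> X" "compact K" "f ` K \<subseteq> K" "\<And>n. exp (a * real n) \<le> real (itin_num K n)"
    and min: "\<And>L. L \<subseteq> K \<Longrightarrow> carries a L \<Longrightarrow> L = K"
    using assms(1) by (auto simp: minimal_carrier_def carries_def)
  have Q: "Q \<subseteq> X" "f ` Q \<subseteq> Q" using assms K(1) by auto
  have Qpow: "(f ^^ n) x \<in> Q" if "x \<in> Q" for x n
    using funpow_mem[OF that Q(2)] .
  \<comment> \<open>By minimality a proper closed invariant subset violates the lower bound
    somewhere. The time can be taken at least 1: a nonempty set satisfies the bound at time 0, and
    the empty set violates it at time 1.\<close>
  have small: "\<exists>m\<ge>1. real (itin_num L m) < exp (a * real m)"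
    if L: "L \<subseteq> K" "L \<noteq> K" "compact L" "f ` L \<subseteq> L" for L
  proof (rule ccontr)
    assume "\<not> ?thesis"
    then have ge: "exp (a * real n) \<le> real (itin_num L n)" if "n \<ge> 1" for n
      using that not_less by blast
    have LX: "L \<subseteq> X" using L(1) K(1) by blast
    have "L \<noteq> {}"
    proof
      assume "L = {}"
      then have "itin_num L 1 = 0" using itin_num_le[of "{}" 1 L] by simp
      then show False using ge[of 1] by simp
    qed
    then have "exp (a * real 0) \<le> real (itin_num L 0)"
      using itin_num_pos[OF LX] by simp
    then have "exp (a * real n) \<le> real (itin_num L n)" for n
      using ge by (cases "n = 0") auto
    then have "carries a L" using L LX by (simp add: carries_def)
    then show False using min L by blast
  qed
  obtain G where G: "open G" "V = K \<inter> G"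
    using assms(6) by (auto simp: openin_open)
  \<comment> \<open>Relative openness of \<open>V\<close> makes these sets compact, so that a bound
    for their intersection \<open>Winf\<close> is inherited by one of them.\<close>
  define W where "W t = {x \<in> K. \<forall>i<t. (f ^^ i) x \<notin> V}" for t
  have Kpow: "(f ^^ n) x \<in> K" if "x \<in> K" for x n
    using funpow_mem[OF that K(3)] .
  have W_cpt: "compact (W t)" for t
  proof (induction t)
    case 0
    then show ?case using K(2) by (simp add: W_def)
  next
    case (Suc t)
    have "W (Suc t) = W t \<inter> {x \<in> K. (f ^^ t) x \<in> - G}"
      using Kpow G(2) by (auto simp: W_def less_Suc_eq)
    moreover have "compact {x \<in> K. (f ^^ t) x \<in> - G}"
      using G(1) K by (intro compact_vimage) auto
    ultimately show ?case using Suc by (simp add: compact_Int)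
  qed
  have WK: "W t \<subseteq> K" for t by (auto simp: W_def)
  have WX: "W t \<subseteq> X" for t using WK K(1) by blast
  have W_anti: "W t \<subseteq> W s" if "s \<le> t" for s t using that by (auto simp: W_def)
  have W_shift: "(f ^^ m) ` W (t + m) \<subseteq> W t" for m t
  proof
    fix y assume "y \<in> (f ^^ m) ` W (t + m)"
    then obtain x where x: "x \<in> W (t + m)" "y = (f ^^ m) x" by blast
    have "(f ^^ i) y \<notin> V" if "i < t" for i
    proof -
      have "(f ^^ i) y = (f ^^ (i + m)) x" by (simp add: x(2) funpow_add)
      then show ?thesis using x(1) that by (simp add: W_def)
    qed
    then show "y \<in> W t" using x Kpow by (simp add: W_def)
  qed
  define Winf where "Winf = (\<Inter>t. W t)"
  have Winf_anti: "Winf \<noteq> K" "Winf \<subseteq> K"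
  proof -
    obtain x where "x \<in> V" using assms(5,7) by blast
    then have "x \<in> K" "x \<notin> W 1" using G by (auto simp: W_def)
    then show "Winf \<noteq> K" by (auto simp: Winf_def)
    show "Winf \<subseteq> K" using WK by (auto simp: Winf_def)
  qed
  have "closed Winf" unfolding Winf_def using W_cpt compact_imp_closed by blast
  then have "compact (K \<inter> Winf)" using K(2) by (simp add: compact_Int_closed)
  then have Winf_cpt: "compact Winf" using Winf_anti(2) by (simp add: Int_absorb1)
  have "f ` Winf \<subseteq> Winf"
  proof -
    have "f x \<in> W t" if "x \<in> Winf" for x t
      using that W_shift[of 1 t] unfolding Winf_def by auto
    then show ?thesis by (auto simp: Winf_def)
  qed
  then obtain m where m: "m \<ge> 1" "real (itin_num Winf m) < exp (a * real m)"
    using small[of Winf] Winf_anti Winf_cpt by blast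
  obtain s where s: "itin_num (W s) m \<le> itin_num Winf m"
  proof (rule itin_num_chain_Inter[of "range W" m])
    show "K \<subseteq> L \<or> L \<subseteq> K" if KL: "K \<in> range W" "L \<in> range W" for K L
    proof -
      obtain i j where "K = W i" "L = W j" using KL by blast
      then show ?thesis using W_anti[of i j] W_anti[of j i] by (cases "i \<le> j") auto
    qed
  qed (use W_cpt WX in \<open>auto simp: Winf_def\<close>)
  then have s': "real (itin_num (W s) m) < exp (a * real m)" using m by linarith
  obtain b1 where b1: "0 \<le> b1" "b1 < a" "real (itin_num (W s) m) \<le> exp (b1 * real m)"
    using exp_rate_obtain[OF \<open>a > 0\<close> m(1) s'] .
  obtain C1 where C1: "C1 \<ge> 1" "\<And>t. real (itin_num (W t) t) \<le> C1 * exp (b1 * real t)"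
    using itin_num_growth[of W m b1 s, OF WX W_anti W_shift m(1) b1(1,3)] by blast
  obtain q where q: "q \<ge> 1" "real (itin_num Q q) < exp (a * real q)"
    using small[of Q] assms(3,4) \<open>Q \<noteq> K\<close> Q(2) by blast
  obtain b2 where b2: "0 \<le> b2" "b2 < a" "real (itin_num Q q) \<le> exp (b2 * real q)"
    using exp_rate_obtain[OF \<open>a > 0\<close> q] .
  obtain C2 where C2: "C2 \<ge> 1" "\<And>t. real (itin_num Q t) \<le> C2 * exp (b2 * real t)"
  proof (rule itin_num_growth[of "\<lambda>_. Q" q b2 0])
    show "(f ^^ q) ` Q \<subseteq> Q" using Qpow by blast
  qed (use b2 q Q in auto)
  define b where "b = max b1 b2"
  have b: "b < a" "b1 \<le> b" "b2 \<le> b" using b1 b2 by (auto simp: b_def)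
  have le: "real (itin_num K n) \<le> (C1 * C2) * (real n + 1) * exp (b * real n)" for n
  proof -
    \<comment> \<open>Points entering at time \<open>t\<close> pay the avoiding rate
      \<open>b1\<close> up to \<open>t\<close> and the rate \<open>b2\<close> of \<open>Q\<close>
      afterwards.\<close>
    define S where "S t = {x \<in> W t. (f ^^ t) x \<in> Q}" for t
    have SX: "S t \<subseteq> X" for t using WX by (auto simp: S_def)
    have S_le: "real (itin_num (S t) n) \<le> C1 * C2 * exp (b * real n)" if "t \<le> n" for t
    proof -
      have "itin_num (S t) (t + (n - t)) \<le> itin_num (S t) t * itin_num Q (n - t)"
        using SX Q by (intro itin_num_add) (auto simp: S_def)
      also have "\<dots> \<le> itin_num (W t) t * itin_num Q (n - t)"
        using WX by (intro mult_right_mono itin_num_mono) (auto simp: S_def)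
      finally have "real (itin_num (S t) n) \<le> real (itin_num (W t) t) * real (itin_num Q (n - t))"
        using that by (metis le_add_diff_inverse of_nat_le_iff of_nat_mult)
      also have "\<dots> \<le> (C1 * exp (b1 * real t)) * (C2 * exp (b2 * real (n - t)))"
        using C1 C2 by (intro mult_mono) auto
      also have "\<dots> \<le> (C1 * exp (b * real t)) * (C2 * exp (b * real (n - t)))"
        using C1(1) C2(1) b by (intro mult_mono mult_left_mono) (auto intro!: mult_right_mono)
      also have "\<dots> = C1 * C2 * exp (b * real t + b * real (n - t))"
        by (simp add: exp_add)
      also have "b * real t + b * real (n - t) = b * real n"
        using that by (simp add: of_nat_diff algebra_simps)
      finally show ?thesis .
    qed
    have "K \<subseteq> W n \<union> (\<Union>t\<in>{..<n}. S t)"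
    proof
      fix x assume "x \<in> K"
      show "x \<in> W n \<union> (\<Union>t\<in>{..<n}. S t)"
      proof (cases "\<exists>t<n. (f ^^ t) x \<in> V")
        case False
        then show ?thesis using \<open>x \<in> K\<close> by (auto simp: W_def)
      next
        case True
        define t where "t = (LEAST t. (f ^^ t) x \<in> V)"
        have "(f ^^ t) x \<in> V" using True unfolding t_def by (metis LeastI)
        moreover have "(f ^^ i) x \<notin> V" if "i < t" for i
          using not_less_Least that unfolding t_def by metis
        moreover have "t < n" using True Least_le unfolding t_def by (metis le_less_trans)
        ultimately have "x \<in> S t" using \<open>x \<in> K\<close> assms(8) by (auto simp: S_def W_def)
        then show ?thesis using \<open>t < n\<close> by blast
      qed
    qed
    then have "itin_num K n \<le> itin_num (W n \<union> (\<Union>t\<in>{..<n}. S t)) n"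
      using WX SX by (intro itin_num_mono) blast+
    also have "\<dots> \<le> itin_num (W n) n + itin_num (\<Union>t\<in>{..<n}. S t) n"
      using WX SX by (intro itin_num_Un) blast+
    also have "\<dots> \<le> itin_num (W n) n + (\<Sum>t<n. itin_num (S t) n)"
      using SX by (intro add_left_mono itin_num_UN) blast+
    finally have "real (itin_num K n) \<le> real (itin_num (W n) n) + (\<Sum>t<n. real (itin_num (S t) n))"
      by (metis of_nat_add of_nat_le_iff of_nat_sum)
    also have "\<dots> \<le> C1 * C2 * exp (b * real n) + (\<Sum>t<n. C1 * C2 * exp (b * real n))"
    proof (intro add_mono sum_mono)
      have "real (itin_num (W n) n) \<le> C1 * exp (b1 * real n)" using C1(2) .
      also have "\<dots> \<le> C1 * exp (b * real n)"
        using C1(1) b by (auto intro!: mult_left_mono mult_right_mono)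
      also have "\<dots> \<le> C1 * C2 * exp (b * real n)"
        using C1(1) C2(1) by (intro mult_right_mono) auto
      finally show "real (itin_num (W n) n) \<le> C1 * C2 * exp (b * real n)" .
    qed (use S_le in auto)
    also have "\<dots> = (C1 * C2) * (real n + 1) * exp (b * real n)"
      by (simp add: algebra_simps)
    finally show ?thesis .
  qed
  obtain n where "(C1 * C2) * (real n + 1) * exp (b * real n) < exp (a * real n)"
    using linear_times_exp_less_exp[OF b(1)] .
  then show False using le[of n] K(4)[of n] by linarith
qed

end


section \<open>Chains\<close>

definition chain :: "'a::metric_space set \<Rightarrow> ('a \<Rightarrow> 'a) \<Rightarrow> real \<Rightarrow> nat \<Rightarrow> (nat \<Rightarrow> 'a) \<Rightarrow> bool" where
  "chain K f d n w \<longleftrightarrow> (\<forall>i\<le>n. w i \<in> K) \<and> (\<forall>i<n. dist (f (w i)) (w (Suc i)) < d)"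

definition chain_to :: "'a::metric_space set \<Rightarrow> ('a \<Rightarrow> 'a) \<Rightarrow> real \<Rightarrow> nat \<Rightarrow> 'a \<Rightarrow> 'a \<Rightarrow> bool" where
  "chain_to K f d n x y \<longleftrightarrow> (\<exists>w. chain K f d n w \<and> w 0 = x \<and> w n = y)"

lemma chain_append:
  assumes "chain K f d m v" "chain K f d n w" "v m = w 0"
  shows "chain K f d (m + n) (\<lambda>i. if i \<le> m then v i else w (i - m))"
  unfolding chain_def
proof (intro conjI allI impI)
  fix i assume "i \<le> m + n"
  then show "(if i \<le> m then v i else w (i - m)) \<in> K"
    using assms(1,2) by (auto simp: chain_def)
next
  fix i assume i: "i < m + n"
  consider "i < m" | "i = m" | "i > m" by linarith
  then show "dist (f (if i \<le> m then v i else w (i - m)))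
      (if Suc i \<le> m then v (Suc i) else w (Suc i - m)) < d"
  proof cases
    case 1
    then show ?thesis using assms(1) by (simp add: chain_def)
  next
    case 2
    then show ?thesis using assms i by (simp add: chain_def)
  next
    case 3
    then have "dist (f (w (i - m))) (w (Suc (i - m))) < d"
      using assms(2) i by (simp add: chain_def)
    then show ?thesis using 3 by (simp add: Suc_diff_le)
  qed
qed

lemma chain_to_trans:
  assumes "chain_to K f d m x y" "chain_to K f d n y z"
  shows "chain_to K f d (m + n) x z"
proof -
  obtain v w where vw: "chain K f d m v" "v 0 = x" "v m = y" "chain K f d n w" "w 0 = y" "w n = z"
    using assms unfolding chain_to_def by blast
  have "chain K f d (m + n) (\<lambda>i. if i \<le> m then v i else w (i - m))"
    using vw by (intro chain_append) auto
  moreover have "(if m + n \<le> m then v (m + n) else w (m + n - m)) = z"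
    using vw by (cases "n = 0") auto
  ultimately show ?thesis
    unfolding chain_to_def using vw(2)
    by (intro exI[of _ "\<lambda>i. if i \<le> m then v i else w (i - m)"]) simp
qed

lemma chain_to_refl: "x \<in> K \<Longrightarrow> chain_to K f d 0 x x"
  unfolding chain_to_def chain_def by (intro exI[of _ "\<lambda>_. x"]) auto

lemma chain_to_step: "x \<in> K \<Longrightarrow> y \<in> K \<Longrightarrow> dist (f x) y < d \<Longrightarrow> chain_to K f d 1 x y"
  unfolding chain_to_def chain_def by (intro exI[of _ "\<lambda>i. if i = 0 then x else y"]) auto

lemma chain_to_mem: "chain_to K f d n x y \<Longrightarrow> x \<in> K \<and> y \<in> K"
  unfolding chain_to_def chain_def by auto

lemma chain_to_mono: "chain_to K f d n x y \<Longrightarrow> d \<le> e \<Longrightarrow> K \<subseteq> L \<Longrightarrow> chain_to L f e n x y"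
  unfolding chain_to_def chain_def by (elim exE, rule exI) (auto intro: order_less_le_trans)

lemma chain_to_Suc_iff:
  "chain_to K f d (Suc n) x y \<longleftrightarrow> y \<in> K \<and> (\<exists>z. chain_to K f d n x z \<and> dist (f z) y < d)"
proof
  assume "chain_to K f d (Suc n) x y"
  then obtain w where "chain K f d (Suc n) w" "w 0 = x" "w (Suc n) = y"
    unfolding chain_to_def by blast
  then have "y \<in> K \<and> (chain K f d n w \<and> w 0 = x) \<and> dist (f (w n)) y < d"
    unfolding chain_def by auto
  then have "y \<in> K \<and> chain_to K f d n x (w n) \<and> dist (f (w n)) y < d"
    unfolding chain_to_def by blast
  then show "y \<in> K \<and> (\<exists>z. chain_to K f d n x z \<and> dist (f z) y < d)" by blast
next
  assume "y \<in> K \<and> (\<exists>z. chain_to K f d n x z \<and> dist (f z) y < d)"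
  then obtain z where "y \<in> K" "chain_to K f d n x z" "dist (f z) y < d" by blast
  then show "chain_to K f d (Suc n) x y"
    using chain_to_trans[OF _ chain_to_step, of K f d n x z y] chain_to_mem[of K f d n x z] by simp
qed

text \<open>Only the last jump involves the end point; with \<open>n = 0\<close> there would be no
  jump to absorb the change.\<close>

lemma chain_to_perturb:
  assumes "chain_to K f d n x y" "n \<ge> 1" "y' \<in> K" "dist y y' < e"
  shows "chain_to K f (d + e) n x y'"
proof -
  obtain m where m: "n = Suc m" using assms(2) by (cases n) auto
  then obtain z where z: "chain_to K f d m x z" "dist (f z) y < d"
    using assms(1) chain_to_Suc_iff by blast
  have "0 \<le> e" using assms(4) zero_le_dist[of y y'] by linarith
  then have "chain_to K f (d + e) m x z" using z(1) by (rule_tac chain_to_mono) auto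
  moreover have "dist (f z) y' < d + e"
    using z(2) assms(4) dist_triangle[of "f z" y' y] by linarith
  ultimately show ?thesis using assms(3) m chain_to_Suc_iff by blast
qed

lemma chain_to_orbit:
  assumes "x \<in> K" "f ` K \<subseteq> K" "d > 0"
  shows "chain_to K f d n x ((f ^^ n) x)"
proof (induction n)
  case 0
  then show ?case using chain_to_refl assms by simp
next
  case (Suc n)
  then have "f ((f ^^ n) x) \<in> K" using chain_to_mem assms by blast
  with Suc assms show ?case by (auto simp: chain_to_Suc_iff)
qed

lemma chain_to_power: "chain_to K f d n x x \<Longrightarrow> chain_to K f d (k * n) x x"
proof (induction k)
  case 0
  then have "x \<in> K" using chain_to_mem by blast
  then show ?case using chain_to_refl by simp
next
  case (Suc k)
  then show ?case using chain_to_trans[of K f d n x x "k * n" x] by simp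
qed

section \<open>Chains inside the minimal carrier\<close>

context covered_system
begin

text \<open>The set \<open>R\<close> of points reached from \<open>x\<close> in at least one step is
  relatively open, and \<open>f\<close> maps its closure into \<open>R\<close>, since the last jump
  absorbs the passage to a limit. The trapping lemma makes \<open>R\<close> dense in
  \<open>K\<close>.\<close>

lemma minimal_carrier_transitive:
  assumes "minimal_carrier a K" "a > 0" "x \<in> K" "y \<in> K" "d > 0"
  shows "\<exists>n\<ge>1. chain_to K f d n x y"
proof -
  have K: "K \<subseteq> X" "compact K" "f ` K \<subseteq> K"
    using assms(1) by (auto simp: minimal_carrier_def carries_def)
  \<comment> \<open>One half of \<open>d\<close> serves reachability, the other moves from the dense
    set to \<open>y\<close>.\<close>
  define e where "e = d / 2"
  have e: "e > 0" "e + e = d" using \<open>d > 0\<close> by (auto simp: e_def)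
  define R where "R = {y. \<exists>n. chain_to K f e (Suc n) x y}"
  have R_iff: "y \<in> R \<longleftrightarrow> y \<in> K \<and> (\<exists>n z. chain_to K f e n x z \<and> dist (f z) y < e)" for y
    unfolding R_def by (auto simp: chain_to_Suc_iff)
  define G where "G = (\<Union>z\<in>{z. \<exists>n. chain_to K f e n x z}. ball (f z) e)"
  have "R = K \<inter> G"
  proof (rule set_eqI)
    fix y
    have "y \<in> G \<longleftrightarrow> (\<exists>n z. chain_to K f e n x z \<and> dist (f z) y < e)"
      by (auto simp: G_def)
    then show "y \<in> R \<longleftrightarrow> y \<in> K \<inter> G" using R_iff[of y] by simp
  qed
  moreover have "open G" by (auto simp: G_def)
  ultimately have op: "openin (top_of_set K) R"
    by (auto simp: openin_open)
  have "closure R \<subseteq> K"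
    using R_iff K(2) compact_imp_closed by (intro closure_minimal) auto
  have "closure R = K"
  proof (rule minimal_carrier_trapping[OF assms(1,2) _ _ _ op])
    show "compact (closure R)"
      using \<open>closure R \<subseteq> K\<close> K(2) by (metis Int_absorb1 closed_closure compact_Int_closed)
    show "closure R \<subseteq> K" by fact
    have "chain_to K f e 0 x x" "f x \<in> K" using assms(3) chain_to_refl K(3) by blast+
    moreover have "dist (f x) (f x) < e" using e(1) by simp
    ultimately have "f x \<in> R" using R_iff[of "f x"] by blast
    then show "closure R \<noteq> {}" using closure_subset by blast
    show "R \<subseteq> closure R" by (rule closure_subset)
    show "f ` closure R \<subseteq> R"
    proof
      fix v assume "v \<in> f ` closure R"
      then obtain u where u: "u \<in> closure R" "v = f u" by blast
      then have "u \<in> K" using \<open>closure R \<subseteq> K\<close> by blast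
      have "continuous_on K f" using cont_f K(1) continuous_on_subset by blast
      then obtain r where r: "r > 0" "\<And>z. z \<in> K \<Longrightarrow> dist z u < r \<Longrightarrow> dist (f z) (f u) < e"
        using \<open>u \<in> K\<close> e(1) unfolding continuous_on_iff by metis
      obtain z where z: "z \<in> R" "dist z u < r"
        using u(1) r(1) by (meson closure_approachable)
      have "z \<in> K" using z(1) R_iff by blast
      then have "dist (f z) (f u) < e" using r(2) z(2) by blast
      moreover obtain n where "chain_to K f e (Suc n) x z" using z(1) by (auto simp: R_def)
      moreover have "f u \<in> K" using \<open>u \<in> K\<close> K(3) by blast
      ultimately show "v \<in> R" using R_iff u(2) by blast
    qed
  qed
  then have "y \<in> closure R" using assms(4) by simp
  then obtain z where z: "z \<in> R" "dist z y < e" using e(1) by (meson closure_approachable)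
  then obtain n where "chain_to K f e (Suc n) x z" by (auto simp: R_def)
  then have "chain_to K f (e + e) (Suc n) x y"
    using z(2) assms(4) by (intro chain_to_perturb[of K f e "Suc n" x z]) auto
  then show ?thesis using e(2) by (intro exI[of _ "Suc n"]) auto
qed

text \<open>Sorting the points of \<open>K\<close> by the length, modulo a loop length \<open>c\<close>, of the chains that reach
  them gives \<open>c\<close> classes permuted cyclically by \<open>f\<close>; were all of them contained in members of \<open>U\<close>,
  \<open>c\<close> itineraries would suffice.\<close>

lemma common_length_fixed:
  assumes "minimal_carrier a K" "a > 0" "x \<in> K" "d > 0"
    and Z: "\<And>E. E \<subseteq> K \<Longrightarrow> (\<forall>u\<in>E. \<forall>v\<in>E. (u, v) \<notin> Z) \<Longrightarrow> \<exists>V\<in>U. E \<subseteq> V"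
  shows "\<exists>u v. (u, v) \<in> Z \<and> (\<exists>l\<ge>1. chain_to K f d l x u \<and> chain_to K f d l x v)"
proof -
  have K: "K \<subseteq> X" "compact K" "f ` K \<subseteq> K" "\<And>n. exp (a * real n) \<le> real (itin_num K n)"
    using assms(1) by (auto simp: minimal_carrier_def carries_def)
  obtain c where c: "c \<ge> 1" "chain_to K f d c x x"
    using minimal_carrier_transitive[OF assms(1-3,3,4)] by blast
  \<comment> \<open>These classes may overlap; what counts is that they cover \<open>K\<close> and
    that \<open>f\<close> sends class \<open>r\<close> into class \<open>r + 1\<close>.\<close>
  define E where "E r = {y. \<exists>n. chain_to K f d n x y \<and> n mod c = r mod c}" for r
  have EK: "E r \<subseteq> K" for r using chain_to_mem by (fastforce simp: E_def)
  have E_mod: "E (r mod c) = E r" for r by (simp add: E_def)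
  have K_E: "\<exists>r<c. y \<in> E r" if yK: "y \<in> K" for y
  proof -
    obtain n where "chain_to K f d n x y"
      using minimal_carrier_transitive[OF assms(1-3) yK assms(4)] by blast
    then show ?thesis using c(1) by (intro exI[of _ "n mod c"]) (auto simp: E_def)
  qed
  have E_f: "(f ^^ i) y \<in> E (r + i)" if yE: "y \<in> E r" for r i y
  proof -
    obtain n where n: "chain_to K f d n x y" "n mod c = r mod c" using yE by (auto simp: E_def)
    have "y \<in> K" using yE EK by blast
    then have "chain_to K f d (n + i) x ((f ^^ i) y)"
      using chain_to_trans[OF n(1) chain_to_orbit] K(3) \<open>d > 0\<close> by blast
    moreover have "(n + i) mod c = (r + i) mod c" using n(2) by (metis mod_add_left_eq)
    ultimately show ?thesis by (auto simp: E_def)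
  qed
  have "\<exists>r. \<not> (\<exists>V\<in>U. E r \<subseteq> V)"
  proof (rule ccontr)
    assume "\<not> ?thesis"
    then obtain V where V: "\<And>r. V r \<in> U" "\<And>r. E r \<subseteq> V r" by metis
    have le: "itin_num K n \<le> c" for n
    proof -
      define D where "D = (\<lambda>r. X \<inter> (\<Inter>i\<in>{..<n}. (f ^^ i) -` V (r + i))) ` {..<c}"
      have "itin_num K n \<le> card D"
      proof (rule itin_num_le)
        show "D \<subseteq> join n" using V(1) by (auto simp: D_def cover_join_def)
        show "finite D" by (simp add: D_def)
        show "K \<subseteq> \<Union>D"
        proof
          fix y assume "y \<in> K"
          then obtain r where r: "r < c" "y \<in> E r" using K_E by blast
          have "y \<in> X \<inter> (\<Inter>i\<in>{..<n}. (f ^^ i) -` V (r + i))"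
            using E_f[OF r(2)] V(2) \<open>y \<in> K\<close> K(1) by blast
          then show "y \<in> \<Union>D" using r(1) by (auto simp: D_def)
        qed
      qed
      also have "\<dots> \<le> c" unfolding D_def using card_image_le[of "{..<c}"] by simp
      finally show ?thesis .
    qed
    obtain n :: nat where "real c / a < real n" using reals_Archimedean2 by blast
    then have "real c < a * real n" using \<open>a > 0\<close> by (simp add: divide_simps mult.commute)
    also have "\<dots> < exp (a * real n)" using exp_ge_add_one_self[of "a * real n"] by linarith
    also have "\<dots> \<le> real c" using K(4)[of n] le[of n] by linarith
    finally show False by simp
  qed
  then obtain r where "\<not> (\<exists>V\<in>U. E r \<subseteq> V)" by blast
  then have "\<not> (\<forall>u\<in>E r. \<forall>v\<in>E r. (u, v) \<notin> Z)" using Z[OF EK] by metis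
  then obtain u v where uv: "u \<in> E r" "v \<in> E r" "(u, v) \<in> Z" by blast
  obtain n where n: "chain_to K f d n x u" "n mod c = r mod c" using uv(1) by (auto simp: E_def)
  obtain m where m: "chain_to K f d m x v" "m mod c = r mod c" using uv(2) by (auto simp: E_def)
  have loop: "chain_to K f d (k * c + j) x y" if "chain_to K f d j x y" for k j y
    using chain_to_trans[OF chain_to_power[OF c(2)] that] .
  \<comment> \<open>Loops of length \<open>c\<close> at \<open>x\<close> are put in front of both
    chains. As \<open>n\<close> and \<open>m\<close> have the same remainder, both totals become
    \<open>l\<close>; the summand 1 keeps \<open>l\<close> positive.\<close>
  define l where "l = (1 + n div c + m div c) * c + r mod c"
  have "l = (1 + m div c) * c + n"
    unfolding l_def n(2)[symmetric] using div_mult_mod_eq[of n c] by (simp add: algebra_simps)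
  then have "chain_to K f d l x u" using loop[OF n(1)] by (simp only:)
  have "l = (1 + n div c) * c + m"
    unfolding l_def m(2)[symmetric] using div_mult_mod_eq[of m c] by (simp add: algebra_simps)
  then have "chain_to K f d l x v" using loop[OF m(1)] by (simp only:)
  moreover have "l \<ge> 1" using c(1) by (simp add: l_def)
  ultimately show ?thesis using uv(3) \<open>chain_to K f d l x u\<close> by blast
qed

text \<open>The pair found for one \<open>d\<close> depends on \<open>d\<close>. A limit of such
  pairs for \<open>d\<close> tending to 0 serves every \<open>d\<close>, and lies in
  \<open>Z\<close> because \<open>Z\<close> is closed.\<close>

lemma common_length_pair:
  assumes "minimal_carrier a K" "a > 0" "closed Z"
    and Z: "\<And>E. E \<subseteq> K \<Longrightarrow> (\<forall>u\<in>E. \<forall>v\<in>E. (u, v) \<notin> Z) \<Longrightarrow> \<exists>V\<in>U. E \<subseteq> V"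
  shows "\<exists>u v. (u, v) \<in> Z \<and> u \<in> K \<and> v \<in> K \<and>
    (\<forall>d>0. \<exists>l\<ge>1. chain_to K f d l u u \<and> chain_to K f d l u v \<and>
      chain_to K f d l v u \<and> chain_to K f d l v v)"
proof -
  have K: "K \<subseteq> X" "compact K" "f ` K \<subseteq> K" "\<And>n. exp (a * real n) \<le> real (itin_num K n)"
    using assms(1) by (auto simp: minimal_carrier_def carries_def)
  have "K \<noteq> {}"
  proof
    assume "K = {}"
    then have "itin_num K 0 = 0" using itin_num_le[of "{}" 0 K] by simp
    then show False using K(4)[of 0] by simp
  qed
  then obtain x where x: "x \<in> K" by blast
  define e where "e k = inverse (real (Suc k))" for k
  have "\<forall>k. \<exists>p\<in>Z. \<exists>l\<ge>1. chain_to K f (e k) l x (fst p) \<and> chain_to K f (e k) l x (snd p)"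
  proof
    fix k
    have "e k > 0" by (simp add: e_def)
    from common_length_fixed[OF assms(1,2) x this Z]
    obtain u v where "(u, v) \<in> Z" "\<exists>l\<ge>1. chain_to K f (e k) l x u \<and> chain_to K f (e k) l x v"
      by blast
    then show "\<exists>p\<in>Z. \<exists>l\<ge>1. chain_to K f (e k) l x (fst p) \<and> chain_to K f (e k) l x (snd p)"
      by (intro bexI[of _ "(u, v)"]) auto
  qed
  then obtain p where p: "\<And>k. p k \<in> Z"
    "\<And>k. \<exists>l\<ge>1. chain_to K f (e k) l x (fst (p k)) \<and> chain_to K f (e k) l x (snd (p k))"
    by metis
  have "compact ((K \<times> K) \<inter> Z)"
    using K(2) assms(3) by (intro compact_Int_closed compact_Times)
  moreover have "\<forall>k. p k \<in> (K \<times> K) \<inter> Z"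
    using p chain_to_mem by (metis IntI mem_Times_iff)
  ultimately obtain q s where q: "q \<in> (K \<times> K) \<inter> Z" "strict_mono s" "(p \<circ> s) \<longlonglongrightarrow> q"
    unfolding compact_def by metis
  obtain u v where uv: "q = (u, v)" by fastforce
  have uvK: "u \<in> K" "v \<in> K" "(u, v) \<in> Z" using q(1) uv by auto
  have lim: "(\<lambda>k. fst (p (s k))) \<longlonglongrightarrow> u" "(\<lambda>k. snd (p (s k))) \<longlonglongrightarrow> v"
    using tendsto_fst[OF q(3)] tendsto_snd[OF q(3)] uv by (auto simp: o_def)
  have e_lim: "(\<lambda>k. e (s k)) \<longlonglongrightarrow> 0"
    using LIMSEQ_subseq_LIMSEQ[OF LIMSEQ_inverse_real_of_nat q(2)] by (simp add: e_def o_def)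
  have common: "\<exists>l\<ge>1. chain_to K f d l x u \<and> chain_to K f d l x v" if d0: "d > 0" for d
  proof -
    have d: "d / 2 > 0" using d0 by simp
    have "\<forall>\<^sub>F k in sequentially. dist (fst (p (s k))) u < d / 2 \<and> dist (snd (p (s k))) v < d / 2
        \<and> e (s k) < d / 2"
      using tendstoD[OF lim(1) d] tendstoD[OF lim(2) d] order_tendstoD(2)[OF e_lim d]
      by (simp add: eventually_conj_iff)
    then obtain k where k: "dist (fst (p (s k))) u < d / 2" "dist (snd (p (s k))) v < d / 2"
        "e (s k) < d / 2"
      unfolding eventually_sequentially by blast
    obtain l where l: "l \<ge> 1" "chain_to K f (e (s k)) l x (fst (p (s k)))"
        "chain_to K f (e (s k)) l x (snd (p (s k)))"
      using p(2) by blast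
    have "chain_to K f (d / 2 + d / 2) l x u"
      using chain_to_perturb[OF chain_to_mono[OF l(2) less_imp_le[OF k(3)] order_refl] l(1) uvK(1) k(1)] .
    moreover have "chain_to K f (d / 2 + d / 2) l x v"
      using chain_to_perturb[OF chain_to_mono[OF l(3) less_imp_le[OF k(3)] order_refl] l(1) uvK(2) k(2)] .
    ultimately show ?thesis using l(1) by auto
  qed
  have "\<exists>l\<ge>1. chain_to K f d l u u \<and> chain_to K f d l u v \<and>
      chain_to K f d l v u \<and> chain_to K f d l v v" if d0: "d > 0" for d
  proof -
    obtain l where l: "l \<ge> 1" "chain_to K f d l x u" "chain_to K f d l x v"
      using common[OF d0] by blast
    obtain r where r: "chain_to K f d r u x"
      using minimal_carrier_transitive[OF assms(1,2) uvK(1) x d0] by blast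
    obtain t where t: "chain_to K f d t v x"
      using minimal_carrier_transitive[OF assms(1,2) uvK(2) x d0] by blast
    \<comment> \<open>The routes \<open>u, x, v, x\<close> and \<open>v, x, u, x\<close> use the
      same three lengths; from \<open>x\<close> both go on to either of \<open>u\<close> and
      \<open>v\<close> in \<open>l\<close> steps.\<close>
    have u: "chain_to K f d (r + l + t) u x"
      using chain_to_trans[OF chain_to_trans[OF r l(3)] t] .
    have v: "chain_to K f d (r + l + t) v x"
      using chain_to_trans[OF chain_to_trans[OF t l(2)] r] by (simp add: ac_simps)
    show ?thesis
      using chain_to_trans[OF u l(2)] chain_to_trans[OF u l(3)]
        chain_to_trans[OF v l(2)] chain_to_trans[OF v l(3)] l(1)
      by (intro exI[of _ "r + l + t + l"]) auto
  qed
  then show ?thesis using uvK by blast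
qed

end


section \<open>Concatenation and shadowing\<close>

lemma block_index:
  fixes l T :: "nat \<Rightarrow> nat"
  assumes "\<And>k. l k \<ge> 1" "T 0 = 0" "\<And>k. T (Suc k) = T k + l k"
  shows "\<exists>k j. j < l k \<and> i = T k + j"
proof (induction i)
  case 0
  then show ?case using assms(1)[of 0] assms(2) by (intro exI[of _ 0]) auto
next
  case (Suc i)
  then obtain k j where kj: "j < l k" "i = T k + j" by blast
  show ?case
  proof (cases "Suc j < l k")
    case True
    then show ?thesis using kj by (intro exI[of _ k] exI[of _ "Suc j"]) auto
  next
    case False
    then have "Suc i = T (Suc k) + 0" using kj assms(3) by simp
    then show ?thesis using assms(1)[of "Suc k"] by (intro exI[of _ "Suc k"] exI[of _ 0]) auto
  qed
qed

lemma block_start_mono: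
  fixes l T :: "nat \<Rightarrow> nat"
  assumes "\<And>k. T (Suc k) = T k + l k" "i \<le> j"
  shows "T i \<le> T j"
  using assms(2) by (rule lift_Suc_mono_le[of T, rotated]) (simp add: assms(1))

lemma block_start_ge:
  fixes l T :: "nat \<Rightarrow> nat"
  assumes "\<And>k. l k \<ge> 1" "\<And>k. T (Suc k) = T k + l k"
  shows "k \<le> T k"
proof (induction k)
  case (Suc k)
  then show ?case using assms(1)[of k] assms(2)[of k] by linarith
qed simp

text \<open>A joint belongs to two blocks, where \<open>glue\<close> makes the values agree. So the
  formula holds up to \<open>j = l k\<close> inclusive, and every jump lies within one
  block.\<close>

lemma concat_blocks:
  fixes l T :: "nat \<Rightarrow> nat" and w :: "nat \<Rightarrow> nat \<Rightarrow> 'a"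
  assumes l: "\<And>k. l k \<ge> 1" and T: "T 0 = 0" "\<And>k. T (Suc k) = T k + l k"
    and glue: "\<And>k. w k (l k) = w (Suc k) 0"
  obtains x where "\<And>k j. j \<le> l k \<Longrightarrow> x (T k + j) = w k j"
proof -
  define B where "B i = (THE k. T k \<le> i \<and> i < T (Suc k))" for i
  have B: "B (T k + j) = k" if "j < l k" for k j
    unfolding B_def
  proof (rule the_equality)
    show "T k \<le> T k + j \<and> T k + j < T (Suc k)" using that T by simp
    fix k' assume k': "T k' \<le> T k + j \<and> T k + j < T (Suc k')"
    have "\<not> k' < k"
      using block_start_mono[of T l, OF T(2), of "Suc k'" k] k' by linarith
    moreover have "\<not> k < k'"
      using block_start_mono[of T l, OF T(2), of "Suc k" k'] T(2)[of k] k' that by linarith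
    ultimately show "k' = k" by simp
  qed
  define x where "x i = w (B i) (i - T (B i))" for i
  have lt: "x (T k + j) = w k j" if "j < l k" for k j
    using B[OF that] by (simp add: x_def)
  have "x (T k + j) = w k j" if "j \<le> l k" for k j
  proof (cases "j = l k")
    case True
    have "x (T (Suc k) + 0) = w (Suc k) 0" using l[of "Suc k"] by (intro lt) simp
    then show ?thesis using True T(2) glue by simp
  qed (use that lt in auto)
  then show ?thesis using that by blast
qed

text \<open>Blocks before \<open>n\<close> are over by time \<open>T n\<close>. The form with
  \<open>k \<ge> n\<close> serves constant sizes of jump as well as sizes tending to 0.\<close>

lemma concat_chains_step:
  fixes l T :: "nat \<Rightarrow> nat" and w :: "nat \<Rightarrow> nat \<Rightarrow> 'a::metric_space"
  assumes l: "\<And>k. l k \<ge> 1" and T: "T 0 = 0" "\<And>k. T (Suc k) = T k + l k"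
    and x: "\<And>k j. j \<le> l k \<Longrightarrow> x (T k + j) = w k j"
    and ch: "\<And>k. chain K f (d k) (l k) (w k)" and "T n \<le> i"
  shows "x i \<in> K \<and> (\<exists>k\<ge>n. dist (f (x i)) (x (Suc i)) < d k)"
proof -
  obtain k j where kj: "j < l k" "i = T k + j" using block_index[of l T, OF l T] by blast
  have "\<not> k < n"
    using block_start_mono[of T l, OF T(2), of "Suc k" n] T(2)[of k] kj \<open>T n \<le> i\<close> by linarith
  moreover have "x i = w k j" "x (Suc i) = w k (Suc j)"
    using x[of j k] x[of "Suc j" k] kj by auto
  ultimately show ?thesis using ch[of k] kj(1) unfolding chain_def
    by (metis less_imp_le_nat not_less)
qed

lemma concat_limit_pseudo_orbit:
  fixes l T :: "nat \<Rightarrow> nat" and w :: "nat \<Rightarrow> nat \<Rightarrow> 'a::metric_space"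
  assumes l: "\<And>k. l k \<ge> 1" and T: "T 0 = 0" "\<And>k. T (Suc k) = T k + l k"
    and x: "\<And>k j. j \<le> l k \<Longrightarrow> x (T k + j) = w k j"
    and ch: "\<And>k. chain X f (d k) (l k) (w k)" and "d \<longlonglongrightarrow> 0"
  shows "limit_pseudo_orbit X f x"
  unfolding limit_pseudo_orbit_def
proof (intro conjI allI)
  have step: "x i \<in> X \<and> (\<exists>k\<ge>n. dist (f (x i)) (x (Suc i)) < d k)" if "T n \<le> i" for n i
    by (rule concat_chains_step[of l T x w X f d n i]) (use l T x ch that in auto)
  show "x i \<in> X" for i using step[of 0 i] T(1) by simp
  show "(\<lambda>i. dist (f (x i)) (x (Suc i))) \<longlonglongrightarrow> 0"
  proof (rule LIMSEQ_I)
    fix e :: real assume "e > 0"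
    then obtain n where n: "\<And>k. k \<ge> n \<Longrightarrow> norm (d k - 0) < e"
      using LIMSEQ_D[OF \<open>d \<longlonglongrightarrow> 0\<close>] by blast
    have "norm (dist (f (x i)) (x (Suc i)) - 0) < e" if i: "i \<ge> T n" for i
    proof -
      obtain k where "k \<ge> n" "dist (f (x i)) (x (Suc i)) < d k" using step[OF i] by blast
      then show ?thesis using n[of k] by simp
    qed
    then show "\<exists>n0. \<forall>i\<ge>n0. norm (dist (f (x i)) (x (Suc i)) - 0) < e" by blast
  qed
qed

section \<open>From limit shadowing to uniform shadowing\<close>

context compact_system
begin

text \<open>Otherwise there are chains with jumps below \<open>1 / (k + 1)\<close> that cannot be
  traced. Joined by connecting chains in \<open>K\<close> they form one limit pseudo orbit, and the
  orbit shadowing it traces all late ones, a contradiction.\<close>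

lemma uniform_shadowing:
  assumes "limit_shadowing X f" "K \<subseteq> X" "e > 0"
    and trans: "\<And>d x y. d > 0 \<Longrightarrow> x \<in> K \<Longrightarrow> y \<in> K \<Longrightarrow> \<exists>n\<ge>1. chain_to K f d n x y"
  obtains d where "d > 0"
    "\<And>n w. chain K f d n w \<Longrightarrow> \<exists>y\<in>X. \<forall>i\<le>n. dist ((f ^^ i) y) (w i) < e"
proof -
  define r where "r k = inverse (real (Suc k))" for k
  have r: "r k > 0" for k by (simp add: r_def)
  have r_lim: "r \<longlonglongrightarrow> 0" unfolding r_def by (rule LIMSEQ_inverse_real_of_nat)
  have "\<exists>d>0. \<forall>n w. chain K f d n w \<longrightarrow> (\<exists>y\<in>X. \<forall>i\<le>n. dist ((f ^^ i) y) (w i) < e)"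
  proof (rule ccontr)
    assume "\<not> ?thesis"
    then have "\<forall>k. \<exists>n w. chain K f (r k) n w \<and> \<not> (\<exists>y\<in>X. \<forall>i\<le>n. dist ((f ^^ i) y) (w i) < e)"
      using r by blast
    then obtain n v where v: "\<And>k. chain K f (r k) (n k) (v k)"
      "\<And>k. \<not> (\<exists>y\<in>X. \<forall>i\<le>n k. dist ((f ^^ i) y) (v k i) < e)" by metis
    have vK: "v k 0 \<in> K" "v k (n k) \<in> K" for k using v(1)[of k] by (auto simp: chain_def)
    have "\<forall>k. \<exists>m\<ge>1. \<exists>u. chain K f (r k) m u \<and> u 0 = v k (n k) \<and> u m = v (Suc k) 0"
      using trans[OF r vK(2) vK(1)] unfolding chain_to_def by blast
    then obtain m u where u: "\<And>k. m k \<ge> 1" "\<And>k. chain K f (r k) (m k) (u k)"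
      "\<And>k. u k 0 = v k (n k)" "\<And>k. u k (m k) = v (Suc k) 0" by metis
    define l where "l k = n k + m k" for k
    define w where "w k i = (if i \<le> n k then v k i else u k (i - n k))" for k i
    define T where "T k = (\<Sum>j<k. l j)" for k
    have l: "l k \<ge> 1" for k using u(1)[of k] by (simp add: l_def)
    have T: "T 0 = 0" "T (Suc k) = T k + l k" for k by (auto simp: T_def)
    have "w k (l k) = w (Suc k) 0" for k
      using u(1,4)[of k] by (simp add: w_def l_def)
    then obtain x where x: "\<And>k j. j \<le> l k \<Longrightarrow> x (T k + j) = w k j"
      using concat_blocks[of l T w, OF l T] by blast
    have "chain K f (r k) (l k) (w k)" for k
      unfolding w_def[abs_def] l_def using v(1) u(2,3) by (intro chain_append) auto
    then have "chain X f (r k) (l k) (w k)" for k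
      using \<open>K \<subseteq> X\<close> unfolding chain_def by blast
    then have "limit_pseudo_orbit X f x"
      by (intro concat_limit_pseudo_orbit[of l T x w X f r]) (use l T x r_lim in auto)
    then obtain y where y: "y \<in> X" "(\<lambda>i. dist ((f ^^ i) y) (x i)) \<longlonglongrightarrow> 0"
      using assms(1) unfolding limit_shadowing_def by blast
    \<comment> \<open>The time from which the error is below \<open>e\<close> doubles as a block
      number, since block \<open>k\<close> starts no earlier than time \<open>k\<close>.\<close>
    obtain k where k: "\<And>i. i \<ge> k \<Longrightarrow> dist ((f ^^ i) y) (x i) < e"
      using LIMSEQ_D[OF y(2) \<open>e > 0\<close>] by auto
    have "dist ((f ^^ i) ((f ^^ T k) y)) (v k i) < e" if i: "i \<le> n k" for i
    proof -
      have "x (T k + i) = v k i" using x[of i k] i by (simp add: l_def w_def)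
      moreover have "k \<le> T k" using block_start_ge[of l T, OF l T(2)] .
      moreover have "(f ^^ i) ((f ^^ T k) y) = (f ^^ (T k + i)) y"
        by (simp add: funpow_add add.commute)
      ultimately show ?thesis using k[of "T k + i"] by simp
    qed
    then show False using v(2)[of k] funpow_in_X[OF y(1)] by blast
  qed
  then show ?thesis using that by blast
qed

lemma funpow_tendsto:
  assumes "\<And>k. z k \<in> X" "a \<in> X" "z \<longlonglongrightarrow> a"
  shows "(\<lambda>k. (f ^^ n) (z k)) \<longlonglongrightarrow> (f ^^ n) a"
  using continuous_on_tendsto_compose[OF cont_funpow assms(3,2)] assms(1) by simp

text \<open>Points tracing ever longer beginnings accumulate at a point tracing everything; the
  limit costs the strictness.\<close>

lemma infinite_shadowing:
  assumes "\<And>n. \<exists>y\<in>X. \<forall>i\<le>n. dist ((f ^^ i) y) (w i) < e"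
  shows "\<exists>y\<in>X. \<forall>i. dist ((f ^^ i) y) (w i) \<le> e"
proof -
  obtain y where y: "\<And>n. y n \<in> X" "\<And>n i. i \<le> n \<Longrightarrow> dist ((f ^^ i) (y n)) (w i) < e"
    using assms by metis
  obtain a s where a: "a \<in> X" "strict_mono s" "(y \<circ> s) \<longlonglongrightarrow> a"
    using compact_X y(1) unfolding compact_def by metis
  have "dist ((f ^^ i) a) (w i) \<le> e" for i
  proof (rule tendsto_upperbound)
    have "(\<lambda>k. (f ^^ i) ((y \<circ> s) k)) \<longlonglongrightarrow> (f ^^ i) a"
      by (rule funpow_tendsto[OF _ a(1,3)]) (simp add: y(1))
    then show "(\<lambda>k. dist ((f ^^ i) ((y \<circ> s) k)) (w i)) \<longlonglongrightarrow> dist ((f ^^ i) a) (w i)"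
      by (intro tendsto_dist tendsto_const)
    have "dist ((f ^^ i) ((y \<circ> s) k)) (w i) \<le> e" if "k \<ge> i" for k
      using y(2)[of i "s k"] that seq_suble[OF a(2), of k] by simp
    then show "\<forall>\<^sub>F k in sequentially. dist ((f ^^ i) ((y \<circ> s) k)) (w i) \<le> e"
      unfolding eventually_sequentially by blast
  qed simp
  then show ?thesis using a(1) by blast
qed

end

section \<open>A recurrent point far from suitable iterates\<close>

text \<open>Coding of the rotation by an irrational angle \<open>\<alpha>\<close> (between 3/10 and 7/10) of the circle of
  length 2 by two half circles: a rotation by \<open>q \<alpha>\<close> close to 1 exchanges the halves except near
  their end points, and no two consecutive points of an orbit are near these.\<close>

lemma alternating_code_exists:
  "\<exists>s :: nat \<Rightarrow> bool. \<forall>c\<ge>1. \<exists>q\<ge>1. c dvd q \<and>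
     (\<forall>i. s i \<noteq> s (i + q) \<or> s (Suc i) \<noteq> s (Suc i + q))"
proof -
  \<comment> \<open>An angle between 2/10 and 8/10 carries the points within 1/10 of an integer off
    that set modulo 1; the narrower interval leaves room to spare.\<close>
  have "uncountable {3/10<..<7/10::real}" by (simp add: uncountable_open_interval)
  then obtain \<alpha> :: real where \<alpha>: "\<alpha> \<notin> \<rat>" "3/10 < \<alpha>" "\<alpha> < 7/10"
    using countable_subset[OF _ countable_rat, of "{3/10<..<7/10::real}"]
    by (metis greaterThanLessThan_iff subsetI)
  define s where "s i = even \<lfloor>real i * \<alpha>\<rfloor>" for i :: nat
  have flip: "s i \<noteq> s (i + q)"
    if q: "\<bar>real q * \<alpha> - (2 * of_int m + 1)\<bar> < 1/10"
      and i: "1/10 \<le> frac (real i * \<alpha>)" "frac (real i * \<alpha>) \<le> 9/10" for i q m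
  proof -
    have "\<lfloor>real (i + q) * \<alpha>\<rfloor> = \<lfloor>real i * \<alpha>\<rfloor> + (2 * m + 1)"
    proof (rule floor_unique)
      have *: "real (i + q) * \<alpha> = real i * \<alpha> + real q * \<alpha>" by (simp add: algebra_simps)
      have q': "real q * \<alpha> - (2 * of_int m + 1) < 1/10" "- (1/10) < real q * \<alpha> - (2 * of_int m + 1)"
        using q by linarith+
      have i': "1/10 \<le> real i * \<alpha> - of_int \<lfloor>real i * \<alpha>\<rfloor>"
        "real i * \<alpha> - of_int \<lfloor>real i * \<alpha>\<rfloor> \<le> 9/10"
        using i by (simp_all add: frac_def)
      have r: "real_of_int (\<lfloor>real i * \<alpha>\<rfloor> + (2 * m + 1)) = of_int \<lfloor>real i * \<alpha>\<rfloor> + (2 * of_int m + 1)"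
        by simp
      show "of_int (\<lfloor>real i * \<alpha>\<rfloor> + (2 * m + 1)) \<le> real (i + q) * \<alpha>"
        "real (i + q) * \<alpha> < of_int (\<lfloor>real i * \<alpha>\<rfloor> + (2 * m + 1)) + 1"
        using q' i' unfolding * r by linarith+
    qed
    then show ?thesis by (simp add: s_def)
  qed
  have middle: "(1/10 \<le> frac (real i * \<alpha>) \<and> frac (real i * \<alpha>) \<le> 9/10) \<or>
    (1/10 \<le> frac (real (Suc i) * \<alpha>) \<and> frac (real (Suc i) * \<alpha>) \<le> 9/10)" for i
  proof -
    define z where "z = real i * \<alpha>"
    have S: "real (Suc i) * \<alpha> = z + \<alpha>" by (simp add: z_def algebra_simps)
    have "frac \<alpha> = \<alpha>" using \<alpha> by (simp add: frac_eq)
    then have "frac (z + \<alpha>) = (if frac z + \<alpha> < 1 then frac z + \<alpha> else frac z + \<alpha> - 1)"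
      by (simp add: frac_add)
    then show ?thesis
      unfolding S z_def[symmetric] using \<alpha>(2,3) frac_ge_0[of z] frac_lt_1[of z]
      by (cases "frac z + \<alpha> < 1"; simp only: if_True if_False; linarith)
  qed
  have "\<exists>q\<ge>1. c dvd q \<and> (\<forall>i. s i \<noteq> s (i + q) \<or> s (Suc i) \<noteq> s (Suc i + q))" if "c \<ge> 1" for c
  proof -
    have "real c * \<alpha> / 2 \<notin> \<rat>"
    proof
      assume "real c * \<alpha> / 2 \<in> \<rat>"
      moreover have "2 / real c \<in> \<rat>" by simp
      ultimately have "real c * \<alpha> / 2 * (2 / real c) \<in> \<rat>" by (rule Rats_mult)
      moreover have "real c * \<alpha> / 2 * (2 / real c) = \<alpha>" using \<open>c \<ge> 1\<close> by simp
      ultimately show False using \<alpha>(1) by (simp only:)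
    qed
    \<comment> \<open>Halving turns the target, an odd integer, into 1/2 modulo 1. Doubling back
      turns the tolerance 1/20 into 1/10, and the factor \<open>c\<close> of the angle becomes a
      factor of \<open>q\<close>.\<close>
    then obtain m k :: int where mk: "k > 0"
      "\<bar>of_int k * (real c * \<alpha> / 2) - of_int m - 1/2\<bar> < 1/20"
      by (rule sequence_of_fractional_parts_is_dense[of "real c * \<alpha> / 2" "1/20" "1/2"]) auto
    define q where "q = nat k * c"
    have "real q * \<alpha> = 2 * (of_int k * (real c * \<alpha> / 2))"
      using mk(1) by (simp add: q_def)
    then have "\<bar>real q * \<alpha> - (2 * of_int m + 1)\<bar> < 1/10"
      using mk(2) by linarith
    then have "\<forall>i. s i \<noteq> s (i + q) \<or> s (Suc i) \<noteq> s (Suc i + q)"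
      using flip middle by blast
    moreover have "q \<ge> 1" using mk(1) \<open>c \<ge> 1\<close> by (simp add: q_def Suc_le_eq)
    ultimately show ?thesis by (intro exI[of _ q]) (simp add: q_def)
  qed
  then show ?thesis by blast
qed

text \<open>The inequalities are non-strict so that the relation passes to limits.\<close>

definition near_pair :: "real \<Rightarrow> 'a::metric_space \<Rightarrow> 'a \<Rightarrow> 'a \<Rightarrow> 'a \<Rightarrow> bool" where
  "near_pair e u v x y \<longleftrightarrow> dist u x \<le> e \<and> dist v y \<le> e"

context compact_system
begin

text \<open>The alternation of the code holds from every index on, so it survives in a limit
  \<open>a\<close> of points of the orbit of \<open>a0\<close>; which of \<open>u\<close> and
  \<open>v\<close> is met first is lost, hence the two alternatives. Chains back to \<open>a\<close>
  come from the orbit of \<open>a0\<close>, which passes near each iterate of \<open>a\<close> and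
  later near \<open>a\<close>.\<close>

lemma recurrent_distal_point:
  assumes "limit_shadowing X f" "K \<subseteq> X" "e > 0" "u \<in> K" "v \<in> K"
    and trans: "\<And>d x y. d > 0 \<Longrightarrow> x \<in> K \<Longrightarrow> y \<in> K \<Longrightarrow> \<exists>n\<ge>1. chain_to K f d n x y"
    and common: "\<And>d. d > 0 \<Longrightarrow> \<exists>l\<ge>1. chain_to K f d l u u \<and> chain_to K f d l u v \<and>
      chain_to K f d l v u \<and> chain_to K f d l v v"
  obtains a N where "a \<in> X" "N \<ge> 1"
    "\<And>d t. d > 0 \<Longrightarrow> \<exists>n\<ge>1. chain_to X f d n ((f ^^ t) a) a"
    "\<And>c. c \<ge> 1 \<Longrightarrow> \<exists>q\<ge>1. c dvd q \<and> (\<forall>i. \<exists>j\<in>{i, Suc i}.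
       near_pair e u v ((f ^^ (j * N)) a) ((f ^^ ((j + q) * N)) a) \<or>
       near_pair e v u ((f ^^ (j * N)) a) ((f ^^ ((j + q) * N)) a))"
proof -
  obtain s :: "nat \<Rightarrow> bool" where s: "\<And>c. c \<ge> 1 \<Longrightarrow> \<exists>q\<ge>1. c dvd q \<and>
     (\<forall>i. s i \<noteq> s (i + q) \<or> s (Suc i) \<noteq> s (Suc i + q))"
    using alternating_code_exists by blast
  obtain d where d: "d > 0"
    "\<And>n w. chain K f d n w \<Longrightarrow> \<exists>y\<in>X. \<forall>i\<le>n. dist ((f ^^ i) y) (w i) < e"
    using uniform_shadowing[OF assms(1-3) trans] by blast
  define P where "P b = (if b then u else v)" for b
  obtain N where N: "N \<ge> 1" "\<And>b b'. chain_to K f d N (P b) (P b')"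
    using common[OF d(1)] by (auto simp: P_def)
  then obtain W where W: "\<And>b b'. chain K f d N (W b b')" "\<And>b b'. W b b' 0 = P b"
      "\<And>b b'. W b b' N = P b'"
    unfolding chain_to_def by metis
  define w where "w k = W (s k) (s (Suc k))" for k
  have T: "0 * N = 0" "Suc k * N = k * N + N" for k by auto
  obtain x where x: "\<And>k j. j \<le> N \<Longrightarrow> x (k * N + j) = w k j"
    using concat_blocks[of "\<lambda>_. N" "\<lambda>k. k * N" w, OF N(1) T] W by (auto simp: w_def)
  have step: "x i \<in> K \<and> dist (f (x i)) (x (Suc i)) < d" for i
  proof -
    have "x i \<in> K \<and> (\<exists>k\<ge>0::nat. dist (f (x i)) (x (Suc i)) < d)"
      by (rule concat_chains_step[of "\<lambda>_. N" "\<lambda>k. k * N" x w]) (use N(1) x W(1) in \<open>auto simp: w_def\<close>)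
    then show ?thesis by simp
  qed
  then have "chain K f d n x" for n by (simp add: chain_def)
  then obtain a0 where a0: "a0 \<in> X" "\<And>i. dist ((f ^^ i) a0) (x i) \<le> e"
    using infinite_shadowing[of x e] d(2) by blast
  have a0P: "dist ((f ^^ (k * N)) a0) (P (s k)) \<le> e" for k
    using a0(2)[of "k * N"] x[of 0 k] W(2) by (simp add: w_def)
  \<comment> \<open>Restricting to multiples of \<open>N\<close> keeps \<open>a\<close> in step with
    the code.\<close>
  obtain a r where a: "a \<in> X" "strict_mono r" "((\<lambda>k. (f ^^ (k * N)) a0) \<circ> r) \<longlonglongrightarrow> a"
    using compact_X funpow_in_X[OF a0(1)] unfolding compact_def by metis
  define z where "z k = (f ^^ (r k * N)) a0" for k
  have z: "z k \<in> X" "z \<longlonglongrightarrow> a" for k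
    using funpow_in_X[OF a0(1)] a(3) by (auto simp: z_def[abs_def] o_def)
  have rec: "\<exists>n\<ge>1. chain_to X f d n ((f ^^ t) a) a" if "d > 0" for d t
  proof -
    have d2: "d / 2 > 0" using that by simp
    \<comment> \<open>The chain must start exactly at \<open>(f ^^ t) a\<close>, so its first jump
      leads to the orbit of \<open>z k\<close> one step later; hence \<open>Suc t\<close>.\<close>
    have lim: "(\<lambda>k. (f ^^ Suc t) (z k)) \<longlonglongrightarrow> (f ^^ Suc t) a"
      using z a(1) by (intro funpow_tendsto)
    obtain k where k: "dist ((f ^^ Suc t) (z k)) ((f ^^ Suc t) a) < d / 2"
      using tendstoD[OF lim d2] unfolding eventually_sequentially by blast
    obtain k' where k': "\<And>i. i \<ge> k' \<Longrightarrow> dist (z i) a < d / 2"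
      using tendstoD[OF z(2) d2] unfolding eventually_sequentially by blast
    \<comment> \<open>Late enough for \<open>z i\<close> to be near \<open>a\<close> and to come
      after \<open>(f ^^ Suc t) (z k)\<close> on the orbit of \<open>a0\<close>.\<close>
    define i where "i = max k' (r k * N + Suc t)"
    have "r i * N \<ge> r k * N + Suc t"
    proof -
      have "r k * N + Suc t \<le> r i" using seq_suble[OF a(2), of i] by (simp add: i_def)
      also have "\<dots> \<le> r i * N" using N(1) by simp
      finally show ?thesis .
    qed
    then obtain n where n: "r i * N = n + (r k * N + Suc t)" by (metis le_add_diff_inverse2)
    have "chain_to X f (d / 2) 1 ((f ^^ t) a) ((f ^^ Suc t) (z k))"
    proof (rule chain_to_step)
      show "dist (f ((f ^^ t) a)) ((f ^^ Suc t) (z k)) < d / 2"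
        using k by (simp add: dist_commute)
    qed (use a(1) z(1) funpow_in_X in blast)+
    moreover have "chain_to X f (d / 2) n ((f ^^ Suc t) (z k)) ((f ^^ n) ((f ^^ Suc t) (z k)))"
      using z(1) funpow_in_X image_f d2 by (intro chain_to_orbit) blast+
    moreover have "(f ^^ n) ((f ^^ Suc t) (z k)) = z i"
    proof -
      have "z i = (f ^^ (n + (Suc t + r k * N))) a0" by (simp add: z_def n add.commute)
      then show ?thesis by (simp only: funpow_add z_def o_apply)
    qed
    ultimately have "chain_to X f (d / 2) (1 + n) ((f ^^ t) a) (z i)"
      using chain_to_trans by metis
    then have "chain_to X f (d / 2 + d / 2) (1 + n) ((f ^^ t) a) a"
      using k'[of i] a(1) by (intro chain_to_perturb) (auto simp: i_def)
    then show ?thesis by (intro exI[of _ "1 + n"]) auto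
  qed
  have distal: "\<exists>q\<ge>1. c dvd q \<and> (\<forall>i. \<exists>j\<in>{i, Suc i}.
       near_pair e u v ((f ^^ (j * N)) a) ((f ^^ ((j + q) * N)) a) \<or>
       near_pair e v u ((f ^^ (j * N)) a) ((f ^^ ((j + q) * N)) a))" if c: "c \<ge> 1" for c
  proof -
    obtain q where q: "q \<ge> 1" "c dvd q" "\<And>i. s i \<noteq> s (i + q) \<or> s (Suc i) \<noteq> s (Suc i + q)"
      using s[OF c] by blast
    \<comment> \<open>Closed sets: every \<open>z k\<close> lies in a union of four of them, hence
      so does the limit \<open>a\<close>.\<close>
    define S where "S u v j = {y \<in> X. (f ^^ (j * N)) y \<in> cball u e} \<inter>
      {y \<in> X. (f ^^ ((j + q) * N)) y \<in> cball v e}" for u v j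
    have S_iff: "y \<in> S u v j \<longleftrightarrow> near_pair e u v ((f ^^ (j * N)) y) ((f ^^ ((j + q) * N)) y)"
      if "y \<in> X" for y u v j
      using that by (auto simp: S_def near_pair_def)
    have "closed (S u v j)" for u v j
      unfolding S_def
      by (intro compact_imp_closed compact_Int compact_vimage[OF order_refl compact_X closed_cball])
    then have cl: "closed (S u v i \<union> S v u i \<union> (S u v (Suc i) \<union> S v u (Suc i)))" for i
      by (intro closed_Un)
    have z_S: "z k \<in> S u v j \<union> S v u j" if "s (r k + j) \<noteq> s (r k + j + q)" for k j
    proof -
      have eq: "(f ^^ (j * N)) (z k) = (f ^^ ((r k + j) * N)) a0" for j
        by (simp add: z_def flip: funpow_add[THEN fun_cong, unfolded o_apply])
          (simp add: algebra_simps)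
      have "dist (P (s (r k + j))) ((f ^^ (j * N)) (z k)) \<le> e"
        "dist (P (s (r k + j + q))) ((f ^^ ((j + q) * N)) (z k)) \<le> e"
        using a0P[of "r k + j"] a0P[of "r k + (j + q)"] unfolding eq
        by (simp_all add: dist_commute add.assoc)
      then show ?thesis using that z(1) by (auto simp: S_def P_def split: if_splits)
    qed
    have "a \<in> S u v i \<union> S v u i \<union> (S u v (Suc i) \<union> S v u (Suc i))" for i
    proof (rule Lim_in_closed_set[OF cl _ _ z(2)])
      have "z k \<in> S u v i \<union> S v u i \<union> (S u v (Suc i) \<union> S v u (Suc i))" for k
        using q(3)[of "r k + i"] z_S[of k i] z_S[of k "Suc i"] by auto
      then show "\<forall>\<^sub>F k in sequentially. z k \<in> S u v i \<union> S v u i \<union> (S u v (Suc i) \<union> S v u (Suc i))"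
        by simp
    qed simp
    then have "\<exists>j\<in>{i, Suc i}. a \<in> S u v j \<or> a \<in> S v u j" for i by blast
    then show ?thesis using q(1,2) S_iff[OF a(1)] by (intro exI[of _ q]) simp
  qed
  show ?thesis using that[OF a(1) N(1) rec distal] .
qed

end


section \<open>Full upper density\<close>

text \<open>Upper density one, put as rarity of exceptions at arbitrarily large times; this passes
  through shifts and finite changes more easily than a limit superior.\<close>

definition upper_full :: "(nat \<Rightarrow> bool) \<Rightarrow> bool" where
  "upper_full P \<longleftrightarrow> (\<forall>e>0. \<forall>m. \<exists>n\<ge>m. n \<ge> 1 \<and> real (card {i. i < n \<and> \<not> P i}) \<le> e * real n)"

lemma limsup_upper_full:
  assumes "upper_full P"
  shows "limsup (\<lambda>n. ereal (real (card {i. i < n \<and> P i}) / real n)) = 1"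
proof (rule antisym)
  have "card {i. i < n \<and> P i} \<le> n" for n
    using card_mono[of "{..<n}" "{i. i < n \<and> P i}"] by auto
  then have "ereal (real (card {i. i < n \<and> P i}) / real n) \<le> 1" for n
    by (cases "n = 0") (auto simp: divide_simps one_ereal_def)
  then show "limsup (\<lambda>n. ereal (real (card {i. i < n \<and> P i}) / real n)) \<le> 1"
    by (intro Limsup_bounded) auto
  show "1 \<le> limsup (\<lambda>n. ereal (real (card {i. i < n \<and> P i}) / real n))"
  proof (rule ccontr)
    assume "\<not> ?thesis"
    then have "limsup (\<lambda>n. ereal (real (card {i. i < n \<and> P i}) / real n)) < ereal 1"
      by (simp add: one_ereal_def)
    then obtain c where c: "limsup (\<lambda>n. ereal (real (card {i. i < n \<and> P i}) / real n)) < ereal c"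
        "ereal c < ereal 1"
      using ereal_dense2 by blast
    obtain m where m: "\<And>n. n \<ge> m \<Longrightarrow> ereal (real (card {i. i < n \<and> P i}) / real n) < ereal c"
      using Limsup_lessD[OF c(1)] unfolding eventually_sequentially by blast
    have "1 - c > 0" using c(2) by simp
    then obtain n where n: "n \<ge> m" "n \<ge> 1" "real (card {i. i < n \<and> \<not> P i}) \<le> (1 - c) * real n"
      using assms unfolding upper_full_def by blast
    have "card {i. i < n \<and> P i} + card {i. i < n \<and> \<not> P i} = card ({i. i < n \<and> P i} \<union> {i. i < n \<and> \<not> P i})"
      by (intro card_Un_disjoint[symmetric]) auto
    also have "{i. i < n \<and> P i} \<union> {i. i < n \<and> \<not> P i} = {..<n}" by auto
    finally have "real (card {i. i < n \<and> P i}) + real (card {i. i < n \<and> \<not> P i}) = real n"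
      by (simp flip: of_nat_add)
    then have "real (card {i. i < n \<and> P i}) \<ge> c * real n"
      using n(3) by (simp add: algebra_simps)
    then show False using m[OF n(1)] n(2) by (simp add: divide_simps)
  qed
qed

lemma upper_full_eventually_mono:
  assumes "upper_full P" "\<And>i. i \<ge> m0 \<Longrightarrow> P i \<Longrightarrow> Q i"
  shows "upper_full Q"
  unfolding upper_full_def
proof (intro allI impI)
  fix e :: real and m :: nat assume "e > 0"
  \<comment> \<open>Beyond \<open>m1\<close> the first \<open>m0\<close> indices are at most an
    \<open>e / 2\<close> share.\<close>
  obtain m1 :: nat where m1: "real m1 > 2 * real m0 / e" using reals_Archimedean2 by blast
  have "e / 2 > 0" using \<open>e > 0\<close> by simp
  then obtain n where n: "n \<ge> max m m1" "n \<ge> 1" "real (card {i. i < n \<and> \<not> P i}) \<le> e / 2 * real n"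
    using assms(1) unfolding upper_full_def by blast
  have "card {i. i < n \<and> \<not> Q i} \<le> card ({..<m0} \<union> {i. i < n \<and> \<not> P i})"
    using assms(2) by (intro card_mono) (auto simp: not_less)
  also have "\<dots> \<le> card {..<m0} + card {i. i < n \<and> \<not> P i}" by (rule card_Un_le)
  finally have "real (card {i. i < n \<and> \<not> Q i}) \<le> real m0 + real (card {i. i < n \<and> \<not> P i})"
    by (metis card_lessThan of_nat_add of_nat_le_iff)
  also have "real m0 \<le> e / 2 * real m1" using m1 \<open>e > 0\<close> by (simp add: divide_simps mult.commute)
  also have "\<dots> \<le> e / 2 * real n" using n(1) \<open>e > 0\<close> by (intro mult_left_mono) auto
  finally have "real (card {i. i < n \<and> \<not> Q i}) \<le> e * real n" using n(3) by simp
  then show "\<exists>n\<ge>m. n \<ge> 1 \<and> real (card {i. i < n \<and> \<not> Q i}) \<le> e * real n"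
    using n by (intro exI[of _ n]) auto
qed

lemma upper_full_shift:
  assumes "upper_full P"
  shows "upper_full (\<lambda>i. P (i + t))"
  unfolding upper_full_def
proof (intro allI impI)
  fix e :: real and m :: nat assume "e > 0"
  then have "e / 2 > 0" by simp
  then obtain n where n: "n \<ge> m + 2 * t + 1" "real (card {i. i < n \<and> \<not> P i}) \<le> e / 2 * real n"
    using assms unfolding upper_full_def by blast
  define k where "k = n - t"
  have k: "n = k + t" "k \<ge> m" "k \<ge> 1" "t \<le> k" using n(1) by (auto simp: k_def)
  have "card {i. i < k \<and> \<not> P (i + t)} = card ((\<lambda>i. i + t) ` {i. i < k \<and> \<not> P (i + t)})"
    by (intro card_image[symmetric]) auto
  also have "\<dots> \<le> card {i. i < n \<and> \<not> P i}" by (intro card_mono) (auto simp: k(1))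
  finally have "real (card {i. i < k \<and> \<not> P (i + t)}) \<le> e / 2 * real n" using n(2) by linarith
  also have "\<dots> \<le> e / 2 * (2 * real k)" using k \<open>e > 0\<close> by (intro mult_left_mono) auto
  finally show "\<exists>n\<ge>m. n \<ge> 1 \<and> real (card {i. i < n \<and> \<not> P (i + t)}) \<le> e * real n"
    using k by (intro exI[of _ k]) auto
qed

text \<open>Exceptions are confined to the first \<open>b\<close> indices, a share of at most
  \<open>1 / (k + 1)\<close>. This fits blocks that are long compared with all that precedes
  them.\<close>

lemma upper_fullI:
  assumes "\<And>m. \<exists>k\<ge>m. \<exists>b n. (k + 1) * b \<le> n \<and> n \<ge> 1 \<and> n \<ge> k \<and> (\<forall>i. b \<le> i \<and> i < n \<longrightarrow> P i)"
  shows "upper_full P"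
  unfolding upper_full_def
proof (intro allI impI)
  fix e :: real and m :: nat assume "e > 0"
  obtain m1 :: nat where m1: "real m1 > 1 / e" using reals_Archimedean2 by blast
  obtain k b n where k: "k \<ge> max m m1" "(k + 1) * b \<le> n" "n \<ge> 1" "n \<ge> k"
      "\<And>i. b \<le> i \<Longrightarrow> i < n \<Longrightarrow> P i"
    using assms[of "max m m1"] by blast
  have "card {i. i < n \<and> \<not> P i} \<le> card {..<b}"
    using k(5) by (intro card_mono) (auto simp: not_less[symmetric])
  then have "real (card {i. i < n \<and> \<not> P i}) \<le> 1 * real b" by simp
  also have "\<dots> \<le> (e * (real k + 1)) * real b"
  proof (intro mult_right_mono)
    have "1 < e * real m1" using m1 \<open>e > 0\<close> by (simp add: divide_simps mult.commute)
    also have "\<dots> \<le> e * (real k + 1)" using k(1) \<open>e > 0\<close> by (intro mult_left_mono) auto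
    finally show "1 \<le> e * (real k + 1)" by simp
  qed simp
  also have "\<dots> = e * real ((k + 1) * b)" by (simp add: algebra_simps)
  also have "\<dots> \<le> e * real n" using k(2) \<open>e > 0\<close> by (intro mult_left_mono of_nat_mono) auto
  finally show "\<exists>n\<ge>m. n \<ge> 1 \<and> real (card {i. i < n \<and> \<not> P i}) \<le> e * real n"
    using k by (intro exI[of _ n]) auto
qed

lemma DC1_pairI:
  assumes "x \<in> X" "y \<in> X" "d0 > 0"
    and "\<And>d. d > 0 \<Longrightarrow> upper_full (\<lambda>i. dist ((f ^^ i) x) ((f ^^ i) y) < d)"
    and "upper_full (\<lambda>i. dist ((f ^^ i) x) ((f ^^ i) y) > d0)"
  shows "DC1_pair X f x y"
  using assms limsup_upper_full unfolding DC1_pair_def by blast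

text \<open>Serves to show that different codes give different points, whence
  uncountability.\<close>

lemma DC1_pair_irrefl: "\<not> DC1_pair X f x x"
proof
  assume "DC1_pair X f x x"
  then obtain d :: real where "d > 0"
    "limsup (\<lambda>n. ereal (real (card {i. i < n \<and> dist ((f ^^ i) x) ((f ^^ i) x) > d}) / real n)) = 1"
    unfolding DC1_pair_def by blast
  then have "limsup (\<lambda>n::nat. ereal 0) = 1" by (simp add: not_less)
  then show False by (simp add: Limsup_const)
qed

section \<open>Coding DC1 pairs\<close>

context compact_system
begin

text \<open>Used contrapositively: points whose orbits are at least \<open>e\<close> apart at some
  time up to \<open>n\<close> are at least \<open>d\<close> apart at the start.\<close>

lemma equicontinuous_iterates:
  assumes "e > 0"
  shows "\<exists>d>0. \<forall>x\<in>X. \<forall>y\<in>X. dist x y < d \<longrightarrow> (\<forall>i\<le>(n::nat). dist ((f ^^ i) x) ((f ^^ i) y) < e)"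
proof (induction n)
  case 0
  then show ?case using assms by auto
next
  case (Suc n)
  then obtain d where d: "d > 0"
    "\<And>x y i. x \<in> X \<Longrightarrow> y \<in> X \<Longrightarrow> dist x y < d \<Longrightarrow> i \<le> n \<Longrightarrow> dist ((f ^^ i) x) ((f ^^ i) y) < e"
    by blast
  have "uniformly_continuous_on X (f ^^ Suc n)"
    by (intro compact_uniformly_continuous cont_funpow compact_X)
  then obtain d' where d': "d' > 0"
    "\<And>x y. x \<in> X \<Longrightarrow> y \<in> X \<Longrightarrow> dist x y < d' \<Longrightarrow> dist ((f ^^ Suc n) x) ((f ^^ Suc n) y) < e"
    using assms unfolding uniformly_continuous_on_def by metis
  have "dist ((f ^^ i) x) ((f ^^ i) y) < e"
    if "x \<in> X" "y \<in> X" "dist x y < min d d'" "i \<le> Suc n" for x y i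
    using d(2)[of x y i] d'(2)[of x y] that by (cases "i = Suc n") auto
  then show ?case using d(1) d'(1) by (intro exI[of _ "min d d'"]) auto
qed

lemma chain_orbit:
  assumes "a \<in> X" "d > 0"
  shows "chain X f d n (\<lambda>i. (f ^^ i) a)"
  using assms funpow_in_X by (simp add: chain_def)

text \<open>Both chains start with loops at \<open>a\<close> and then follow the orbit of \<open>a\<close> for a long time, one of
  them \<open>p\<close> steps ahead of the other; since \<open>p\<close> is a multiple of the length of a loop at \<open>a\<close>,
  inserting loops before or after this makes the lengths agree.\<close>

lemma block_pair:
  assumes a: "a \<in> X" and rec: "\<And>d t. d > 0 \<Longrightarrow> \<exists>n\<ge>1. chain_to X f d n ((f ^^ t) a) a"
    and distal: "\<And>c. c \<ge> 1 \<Longrightarrow> \<exists>p\<ge>1. c dvd p \<and>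
      (\<forall>j. d0 \<le> dist ((f ^^ j) a) ((f ^^ (j + p)) a)) \<and>
      (\<exists>j. R ((f ^^ j) a) ((f ^^ (j + p)) a) \<or> R ((f ^^ (j + p)) a) ((f ^^ j) a))"
    and "d > 0"
  shows "\<exists>l A B C v w. 1 \<le> l \<and> chain X f d l v \<and> chain X f d l w \<and>
    v 0 = a \<and> w 0 = a \<and> v l = a \<and> w l = a \<and>
    A \<le> l \<and> M \<le> A \<and> (\<forall>j<A. v j = w j) \<and>
    C \<le> l \<and> M * (M + B) \<le> C \<and> (\<forall>j. B \<le> j \<and> j < C \<longrightarrow> d0 \<le> dist (v j) (w j)) \<and>
    (\<exists>j\<le>l. R (v j) (w j))"
proof -
  obtain c where c: "c \<ge> 1" "chain_to X f d c a a" using rec[OF \<open>d > 0\<close>, of 0] by auto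
  obtain p j0 where p: "p \<ge> 1" "c dvd p" "\<And>j. d0 \<le> dist ((f ^^ j) a) ((f ^^ (j + p)) a)"
    "R ((f ^^ j0) a) ((f ^^ (j0 + p)) a) \<or> R ((f ^^ (j0 + p)) a) ((f ^^ j0) a)"
    using distal[OF c(1)] by blast
  obtain h where h: "p = h * c" using p(2) by (metis dvdE mult.commute)
  \<comment> \<open>\<open>M\<close> loops of length \<open>c\<close> form the common beginning.
    \<open>B\<close> adds the \<open>p\<close> steps during which \<open>v\<close> loops at
    \<open>a\<close> while \<open>w\<close> already follows the orbit. \<open>L\<close> makes the
    separated stretch long enough and lets it contain \<open>j0\<close>.\<close>
  define A where "A = M * c"
  define B where "B = A + p"
  define L where "L = M * (M + B) + j0 + 1"
  define C where "C = B + L"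
  obtain n where n: "n \<ge> 1" "chain_to X f d n ((f ^^ (p + L)) a) a" using rec[OF \<open>d > 0\<close>] by blast
  obtain g where g: "chain X f d A g" "g 0 = a" "g A = a"
    using chain_to_power[OF c(2), of M] unfolding A_def chain_to_def by blast
  obtain k where k: "chain X f d p k" "k 0 = a" "k p = a"
    using chain_to_power[OF c(2), of h] unfolding h chain_to_def by blast
  obtain r where r: "chain X f d n r" "r 0 = (f ^^ (p + L)) a" "r n = a"
    using n(2) unfolding chain_to_def by blast
  have orb: "chain X f d (p + L) (\<lambda>i. (f ^^ i) a)" using chain_orbit[OF a \<open>d > 0\<close>] .
  define v2 where "v2 i = (if i \<le> p + L then (f ^^ i) a else r (i - (p + L)))" for i
  define v1 where "v1 i = (if i \<le> p then k i else v2 (i - p))" for i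
  define v where "v i = (if i \<le> A then g i else v1 (i - A))" for i
  define w2 where "w2 i = (if i \<le> n then r i else k (i - n))" for i
  define w1 where "w1 i = (if i \<le> p + L then (f ^^ i) a else w2 (i - (p + L)))" for i
  define w where "w i = (if i \<le> A then g i else w1 (i - A))" for i
  define l where "l = A + (p + ((p + L) + n))"
  have starts: "v2 0 = a" "v1 0 = a" "w2 0 = (f ^^ (p + L)) a" "w1 0 = a"
    using k(2) r(2) by (simp_all add: v2_def v1_def w2_def w1_def)
  have v2: "chain X f d ((p + L) + n) v2"
    unfolding v2_def[abs_def] by (intro chain_append[OF orb r(1)]) (simp add: r(2))
  have v1: "chain X f d (p + ((p + L) + n)) v1"
    unfolding v1_def[abs_def] by (intro chain_append[OF k(1) v2]) (simp add: k(3) starts)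
  have v: "chain X f d l v"
    unfolding v_def[abs_def] l_def by (intro chain_append[OF g(1) v1]) (simp add: g(3) starts)
  have w2: "chain X f d (n + p) w2"
    unfolding w2_def[abs_def] by (intro chain_append[OF r(1) k(1)]) (simp add: r(3) k(2))
  have w1: "chain X f d ((p + L) + (n + p)) w1"
    unfolding w1_def[abs_def] by (intro chain_append[OF orb w2]) (simp add: starts)
  have "chain X f d (A + ((p + L) + (n + p))) w"
    unfolding w_def[abs_def] by (intro chain_append[OF g(1) w1]) (simp add: g(3) starts)
  then have w: "chain X f d l w" by (simp add: l_def ac_simps)
  have vB: "v (B + i) = (f ^^ i) a" if "i < L" for i
    using that p(1) k(3) by (cases "i = 0") (auto simp: v_def v1_def v2_def B_def)
  have wB: "w (B + i) = (f ^^ (i + p)) a" if "i < L" for i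
    using that p(1) by (auto simp: w_def w1_def B_def add.commute)
  have ends: "v 0 = a" "w 0 = a" "v l = a" "w l = a"
    using g(2) n(1) p(1) r(3) k(3)
    by (auto simp: v_def v1_def v2_def w_def w1_def w2_def l_def)
  have far: "d0 \<le> dist (v j) (w j)" if jB: "B \<le> j \<and> j < C" for j
  proof -
    obtain i where i: "j = B + i" using le_Suc_ex[OF jB[THEN conjunct1]] by blast
    then have "i < L" using jB by (simp add: C_def)
    then show ?thesis using vB wB p(3)[of i] i by simp
  qed
  have "j0 < L" by (simp add: L_def)
  then have R: "R (v (B + j0)) (w (B + j0)) \<or> R (w (B + j0)) (v (B + j0))"
    using p(4) vB wB by simp
  have le: "1 \<le> l" "A \<le> l" "M \<le> A" "C \<le> l" "M * (M + B) \<le> C" "B + j0 \<le> l"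
    using p(1) c(1) by (auto simp: l_def A_def C_def B_def L_def)
  have eq: "v j = w j" if "j < A" for j using that by (simp add: v_def w_def)
  show ?thesis
    using R
  proof
    assume "R (v (B + j0)) (w (B + j0))"
    then show ?thesis
      using v w ends far le eq
      by (rule_tac exI[of _ l], rule_tac exI[of _ A], rule_tac exI[of _ B], rule_tac exI[of _ C],
          rule_tac exI[of _ v], rule_tac exI[of _ w]) auto
  next
    \<comment> \<open>\<open>R\<close> is directed, so the two blocks exchange their names.\<close>
    assume Rwv: "R (w (B + j0)) (v (B + j0))"
    show ?thesis
    proof (rule exI[of _ l], rule exI[of _ A], rule exI[of _ B], rule exI[of _ C],
        rule exI[of _ w], rule exI[of _ v], intro conjI le v w ends)
      show "\<forall>j<A. w j = v j" using eq by simp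
      show "\<forall>j. B \<le> j \<and> j < C \<longrightarrow> d0 \<le> dist (w j) (v j)"
        using far by (simp add: dist_commute)
      show "\<exists>j\<le>l. R (w j) (v j)" using Rwv le(6) by blast
    qed
  qed
qed

text \<open>Every block gives an agreement, whatever the codes, and a separation where the codes
  differ, each outweighing all that precedes it. As \<open>R\<close> is directed, it needs places
  with \<open>False\<close> against \<open>True\<close> in this order.\<close>

lemma coded_points:
  assumes "limit_shadowing X f" and a: "a \<in> X"
    and rec: "\<And>d t. d > 0 \<Longrightarrow> \<exists>n\<ge>1. chain_to X f d n ((f ^^ t) a) a"
    and distal: "\<And>c. c \<ge> 1 \<Longrightarrow> \<exists>p\<ge>1. c dvd p \<and>
      (\<forall>j. d0 \<le> dist ((f ^^ j) a) ((f ^^ (j + p)) a)) \<and>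
      (\<exists>j. R ((f ^^ j) a) ((f ^^ (j + p)) a) \<or> R ((f ^^ (j + p)) a) ((f ^^ j) a))"
  shows "\<exists>(x :: (nat \<Rightarrow> bool) \<Rightarrow> nat \<Rightarrow> 'a) y.
    (\<forall>\<sigma>. y \<sigma> \<in> X) \<and> (\<forall>\<sigma>. (\<lambda>i. dist ((f ^^ i) (y \<sigma>)) (x \<sigma> i)) \<longlonglongrightarrow> 0) \<and>
    (\<forall>\<sigma> \<tau>. upper_full (\<lambda>i. x \<sigma> i = x \<tau> i)) \<and>
    (\<forall>\<sigma> \<tau>. (\<forall>m. \<exists>k\<ge>m. \<sigma> k \<noteq> \<tau> k) \<longrightarrow> upper_full (\<lambda>i. d0 \<le> dist (x \<sigma> i) (x \<tau> i))) \<and>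
    (\<forall>\<sigma> \<tau> m. (\<forall>m. \<exists>k\<ge>m. \<not> \<sigma> k \<and> \<tau> k) \<longrightarrow> (\<exists>i\<ge>m. R (x \<sigma> i) (x \<tau> i)))"
proof -
  define r where "r k = inverse (real (Suc k))" for k
  have r: "r k > 0" for k by (simp add: r_def)
  have r_lim: "r \<longlonglongrightarrow> 0" unfolding r_def by (rule LIMSEQ_inverse_real_of_nat)
  define good where "good k M l A B C v w \<longleftrightarrow> 1 \<le> l \<and> chain X f (r k) l v \<and> chain X f (r k) l w \<and>
    v 0 = a \<and> w 0 = a \<and> v l = a \<and> w l = a \<and>
    A \<le> l \<and> M \<le> A \<and> (\<forall>j<A. v j = w j) \<and>
    C \<le> l \<and> M * (M + B) \<le> C \<and> (\<forall>j. B \<le> j \<and> j < C \<longrightarrow> d0 \<le> dist (v j) (w j)) \<and>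
    (\<exists>j\<le>l. R (v j) (w j))" for k M l A B C v w
  have "\<forall>k M. \<exists>l A B C v w. good k M l A B C v w"
    unfolding good_def using block_pair[OF a rec distal r] by blast
  then obtain l' A' B' C' v' w' where
    good: "\<And>k M. good k M (l' k M) (A' k M) (B' k M) (C' k M) (v' k M) (w' k M)"
    by metis
  \<comment> \<open>The length of a block depends on \<open>M\<close>, which depends on where the
    block starts; hence a recursion for the starts.\<close>
  define T where "T = rec_nat 0 (\<lambda>k t. t + l' k ((k + 1) * (t + 1)))"
  \<comment> \<open>The factor \<open>k + 1\<close> is the ratio demanded by
    \<open>upper_fullI\<close>; the summand 1 keeps \<open>M k\<close> positive when
    \<open>T k = 0\<close>.\<close>
  define M where "M k = (k + 1) * (T k + 1)" for k
  define l where "l k = l' k (M k)" for k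
  define A where "A k = A' k (M k)" for k
  define B where "B k = B' k (M k)" for k
  define C where "C k = C' k (M k)" for k
  define v where "v k = v' k (M k)" for k
  define w where "w k = w' k (M k)" for k
  have T: "T 0 = 0" "T (Suc k) = T k + l k" for k by (simp_all add: T_def l_def M_def)
  have g: "good k (M k) (l k) (A k) (B k) (C k) (v k) (w k)" for k
    unfolding l_def A_def B_def C_def v_def w_def by (rule good)
  have l1: "1 \<le> l k" for k using g[of k] by (simp add: good_def)
  define b where "b \<sigma> k = (if \<sigma> k then w k else v k)" for \<sigma> :: "nat \<Rightarrow> bool" and k
  have "\<exists>x. \<forall>k j. j \<le> l k \<longrightarrow> x (T k + j) = b \<sigma> k j" for \<sigma>
  proof -
    have "b \<sigma> k (l k) = b \<sigma> (Suc k) 0" for k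
      using g[of k] g[of "Suc k"] by (simp add: b_def good_def)
    then show ?thesis using concat_blocks[of l T "b \<sigma>", OF l1 T] by blast
  qed
  then obtain x where x: "\<And>\<sigma> k j. j \<le> l k \<Longrightarrow> x \<sigma> (T k + j) = b \<sigma> k j" by metis
  have "chain X f (r k) (l k) (b \<sigma> k)" for \<sigma> k
    using g[of k] by (simp add: b_def good_def)
  then have "limit_pseudo_orbit X f (x \<sigma>)" for \<sigma>
    by (intro concat_limit_pseudo_orbit[of l T "x \<sigma>" "b \<sigma>" X f r]) (use l1 T x r_lim in auto)
  then have "\<exists>y\<in>X. (\<lambda>i. dist ((f ^^ i) y) (x \<sigma> i)) \<longlonglongrightarrow> 0" for \<sigma>
    using assms(1) unfolding limit_shadowing_def by blast
  then obtain y where y: "\<And>\<sigma>. y \<sigma> \<in> X" "\<And>\<sigma>. (\<lambda>i. dist ((f ^^ i) (y \<sigma>)) (x \<sigma> i)) \<longlonglongrightarrow> 0"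
    by metis
  have Tk: "k \<le> T k" for k using block_start_ge[of l T, OF l1 T(2)] .
  have M1: "(k + 1) * T k \<le> M k" "k + 1 \<le> M k" "T k \<le> M k" for k
    by (simp_all add: M_def)
  have agree: "upper_full (\<lambda>i. x \<sigma> i = x \<tau> i)" for \<sigma> \<tau>
  proof (rule upper_fullI)
    fix m
    have A: "A m \<le> l m" "M m \<le> A m" "\<And>j. j < A m \<Longrightarrow> v m j = w m j"
      using g[of m] by (simp_all add: good_def)
    have "x \<sigma> i = x \<tau> i" if "T m \<le> i \<and> i < T m + A m" for i
    proof -
      define j where "j = i - T m"
      have j: "i = T m + j" "j < A m" using that by (auto simp: j_def)
      then show ?thesis using x[of j m \<sigma>] x[of j m \<tau>] A(1) A(3)[OF j(2)] by (simp add: b_def)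
    qed
    moreover have "(m + 1) * T m \<le> T m + A m" "T m + A m \<ge> 1" "T m + A m \<ge> m"
      using A(2) M1[of m] by linarith+
    ultimately show "\<exists>k\<ge>m. \<exists>b n. (k + 1) * b \<le> n \<and> n \<ge> 1 \<and> n \<ge> k \<and>
        (\<forall>i. b \<le> i \<and> i < n \<longrightarrow> x \<sigma> i = x \<tau> i)" by blast
  qed
  have differ: "upper_full (\<lambda>i. d0 \<le> dist (x \<sigma> i) (x \<tau> i))" if dif: "\<And>m. \<exists>k\<ge>m. \<sigma> k \<noteq> \<tau> k" for \<sigma> \<tau>
  proof (rule upper_fullI)
    fix m
    obtain k where k: "k \<ge> m" "\<sigma> k \<noteq> \<tau> k" using dif by blast
    have C: "C k \<le> l k" "M k * (M k + B k) \<le> C k"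
      "\<And>j. B k \<le> j \<Longrightarrow> j < C k \<Longrightarrow> d0 \<le> dist (v k j) (w k j)"
      using g[of k] by (simp_all add: good_def)
    have "d0 \<le> dist (x \<sigma> i) (x \<tau> i)" if "T k + B k \<le> i \<and> i < T k + C k" for i
    proof -
      define j where "j = i - T k"
      have j: "i = T k + j" "B k \<le> j" "j < C k" using that by (auto simp: j_def)
      then show ?thesis
        using x[of j k \<sigma>] x[of j k \<tau>] C(1) C(3)[OF j(2,3)] k(2) by (auto simp: b_def dist_commute)
    qed
    moreover have "(k + 1) * (T k + B k) \<le> T k + C k" "T k + C k \<ge> 1"
    proof -
      have "(k + 1) * (T k + B k) \<le> M k * (M k + B k)" using M1[of k] by (intro mult_mono) auto
      then show "(k + 1) * (T k + B k) \<le> T k + C k" using C(2) by linarith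
      have "1 * 1 \<le> M k * (M k + B k)" using M1(2)[of k] by (intro mult_mono) auto
      then show "T k + C k \<ge> 1" using C(2) by linarith
    qed
    moreover have "T k + C k \<ge> k" using Tk[of k] by linarith
    ultimately show "\<exists>k\<ge>m. \<exists>b n. (k + 1) * b \<le> n \<and> n \<ge> 1 \<and> n \<ge> k \<and>
        (\<forall>i. b \<le> i \<and> i < n \<longrightarrow> d0 \<le> dist (x \<sigma> i) (x \<tau> i))" using k(1) by blast
  qed
  have hit: "\<exists>i\<ge>m. R (x \<sigma> i) (x \<tau> i)" if ord: "\<And>m. \<exists>k\<ge>m. \<not> \<sigma> k \<and> \<tau> k" for \<sigma> \<tau> m
  proof -
    obtain k where k: "k \<ge> m" "\<not> \<sigma> k" "\<tau> k" using ord by blast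
    obtain j where "j \<le> l k" "R (v k j) (w k j)" using g[of k] by (auto simp: good_def)
    then have "R (x \<sigma> (T k + j)) (x \<tau> (T k + j))" using x[of j k] k by (simp add: b_def)
    moreover have "m \<le> T k + j" using Tk[of k] k(1) by linarith
    ultimately show ?thesis by blast
  qed
  show ?thesis
    by (rule exI[of _ x], rule exI[of _ y]) (intro conjI allI impI; (fact y agree | rule differ hit, blast))
qed

lemma DC1_from_pair:
  assumes "limit_shadowing X f" "K \<subseteq> X" "e0 > 0" "u \<in> K" "v \<in> K" "u \<noteq> v"
    and trans: "\<And>d x y. d > 0 \<Longrightarrow> x \<in> K \<Longrightarrow> y \<in> K \<Longrightarrow> \<exists>n\<ge>1. chain_to K f d n x y"
    and common: "\<And>d. d > 0 \<Longrightarrow> \<exists>l\<ge>1. chain_to K f d l u u \<and> chain_to K f d l u v \<and>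
      chain_to K f d l v u \<and> chain_to K f d l v v"
  shows "exhibits_DC1 X f \<and> (\<exists>x y. DC1_pair X f x y \<and> dist u x < e0 \<and> dist v y < e0)"
proof -
  \<comment> \<open>Half of \<open>e0\<close> is left for the shadowing error; a third of the
    distance keeps points of the \<open>e\<close>-balls about \<open>u\<close> and \<open>v\<close>
    at least \<open>e\<close> apart.\<close>
  define e where "e = min (e0 / 2) (dist u v / 3)"
  have e: "e > 0" "e \<le> e0 / 2" "3 * e \<le> dist u v"
    using \<open>e0 > 0\<close> \<open>u \<noteq> v\<close> by (auto simp: e_def)
  obtain a N where a: "a \<in> X" "N \<ge> 1"
    and rec: "\<And>d t. d > 0 \<Longrightarrow> \<exists>n\<ge>1. chain_to X f d n ((f ^^ t) a) a"
    and near: "\<And>c. c \<ge> 1 \<Longrightarrow> \<exists>q\<ge>1. c dvd q \<and> (\<forall>i. \<exists>j\<in>{i, Suc i}.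
       near_pair e u v ((f ^^ (j * N)) a) ((f ^^ ((j + q) * N)) a) \<or>
       near_pair e v u ((f ^^ (j * N)) a) ((f ^^ ((j + q) * N)) a))"
    using recurrent_distal_point[OF assms(1,2) e(1) assms(4,5) trans common] by blast
  have near_far: "e \<le> dist x y" if "near_pair e u v x y \<or> near_pair e v u x y" for x y
  proof -
    have "dist u v \<le> dist u x + dist x y + dist v y" "dist u v \<le> dist u y + dist x y + dist v x"
      using dist_triangle[of u v x] dist_triangle[of x v y] dist_triangle[of u v y]
        dist_triangle[of y v x] by (simp_all add: dist_commute)
    then show ?thesis using that e(3) by (auto simp: near_pair_def)
  qed
  obtain d0 where d0: "d0 > 0" "\<And>x y i. x \<in> X \<Longrightarrow> y \<in> X \<Longrightarrow> dist x y < d0 \<Longrightarrow> i \<le> 2 * N \<Longrightarrow>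
      dist ((f ^^ i) x) ((f ^^ i) y) < e"
    using equicontinuous_iterates[OF e(1), of "2 * N"] by blast
  have distal: "\<exists>p\<ge>1. c dvd p \<and> (\<forall>j. d0 \<le> dist ((f ^^ j) a) ((f ^^ (j + p)) a)) \<and>
      (\<exists>j. near_pair e u v ((f ^^ j) a) ((f ^^ (j + p)) a) \<or>
        near_pair e u v ((f ^^ (j + p)) a) ((f ^^ j) a))" if c: "c \<ge> 1" for c
  proof -
    obtain q where q: "q \<ge> 1" "c dvd q" "\<And>i. \<exists>j\<in>{i, Suc i}.
       near_pair e u v ((f ^^ (j * N)) a) ((f ^^ ((j + q) * N)) a) \<or>
       near_pair e v u ((f ^^ (j * N)) a) ((f ^^ ((j + q) * N)) a)"
      using near[OF c] by blast
    have "d0 \<le> dist ((f ^^ j) a) ((f ^^ (j + q * N)) a)" for j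
    proof (rule ccontr)
      assume "\<not> ?thesis"
      then have lt: "dist ((f ^^ j) a) ((f ^^ (j + q * N)) a) < d0" by simp
      \<comment> \<open>\<open>i * N\<close> is the first multiple of \<open>N\<close> after
        \<open>j\<close>, so a separated time \<open>i' * N\<close> comes at most
        \<open>2 * N\<close> steps after \<open>j\<close>. Points closer than \<open>d0\<close> at
        time \<open>j\<close> would still be closer than \<open>e\<close> then.\<close>
      define i where "i = j div N + 1"
      have i: "j \<le> i * N" "i * N \<le> j + N"
      proof -
        have "i * N = j div N * N + N" by (simp add: i_def)
        moreover have "j div N * N + j mod N = j" "j mod N < N" using a(2) by auto
        ultimately show "j \<le> i * N" "i * N \<le> j + N" by linarith+
      qed
      obtain i' where i': "i' \<in> {i, Suc i}" "near_pair e u v ((f ^^ (i' * N)) a) ((f ^^ ((i' + q) * N)) a) \<or>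
       near_pair e v u ((f ^^ (i' * N)) a) ((f ^^ ((i' + q) * N)) a)" using q(3) by blast
      have "j \<le> i' * N" "i' * N \<le> j + 2 * N" using i i'(1) by auto
      then obtain t where t: "i' * N = t + j" "t \<le> 2 * N"
        by (metis add.commute add_le_cancel_left le_add_diff_inverse2)
      have "(i' + q) * N = t + (j + q * N)" using t(1) by (simp add: algebra_simps)
      then have "e \<le> dist ((f ^^ t) ((f ^^ j) a)) ((f ^^ t) ((f ^^ (j + q * N)) a))"
        using near_far[OF i'(2)] t(1) by (simp add: funpow_add)
      moreover have "dist ((f ^^ t) ((f ^^ j) a)) ((f ^^ t) ((f ^^ (j + q * N)) a)) < e"
        using d0(2)[OF _ _ lt t(2)] funpow_in_X[OF a(1)] by blast
      ultimately show False by simp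
    qed
    moreover have "\<exists>j. near_pair e u v ((f ^^ j) a) ((f ^^ (j + q * N)) a) \<or>
        near_pair e u v ((f ^^ (j + q * N)) a) ((f ^^ j) a)"
    proof -
      obtain j where "near_pair e u v ((f ^^ (j * N)) a) ((f ^^ ((j + q) * N)) a) \<or>
         near_pair e v u ((f ^^ (j * N)) a) ((f ^^ ((j + q) * N)) a)" using q(3)[of 0] by blast
      then show ?thesis by (intro exI[of _ "j * N"]) (auto simp: near_pair_def add_mult_distrib)
    qed
    moreover have "q * N \<ge> 1" using q(1) a(2) by simp
    ultimately show ?thesis using q(2) by (intro exI[of _ "q * N"]) auto
  qed
  obtain x :: "(nat \<Rightarrow> bool) \<Rightarrow> nat \<Rightarrow> 'a" and y :: "(nat \<Rightarrow> bool) \<Rightarrow> 'a"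
    where y: "\<forall>\<sigma>. y \<sigma> \<in> X" "\<forall>\<sigma>. (\<lambda>i. dist ((f ^^ i) (y \<sigma>)) (x \<sigma> i)) \<longlonglongrightarrow> 0"
    and agree: "\<forall>\<sigma> \<tau>. upper_full (\<lambda>i. x \<sigma> i = x \<tau> i)"
    and differ: "\<forall>\<sigma> \<tau>. (\<forall>m. \<exists>k\<ge>m. \<sigma> k \<noteq> \<tau> k) \<longrightarrow> upper_full (\<lambda>i. d0 \<le> dist (x \<sigma> i) (x \<tau> i))"
    and close: "\<forall>\<sigma> \<tau> m. (\<forall>m. \<exists>k\<ge>m. \<not> \<sigma> k \<and> \<tau> k) \<longrightarrow> (\<exists>i\<ge>m. near_pair e u v (x \<sigma> i) (x \<tau> i))"
    by (rule coded_points[of a d0 "near_pair e u v", OF assms(1) a(1), THEN exE],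
        rule rec, assumption, rule distal, assumption, elim exE conjE, rule that)
  note y = y[rule_format] and agree = agree[rule_format] and differ = differ[rule_format]
    and close = close[rule_format]
  have y_ev: "\<exists>m. \<forall>i\<ge>m. dist ((f ^^ i) (y \<sigma>)) (x \<sigma> i) < d" if "d > 0" for d \<sigma>
    using LIMSEQ_D[OF y(2) that] by auto
  have DC1: "DC1_pair X f ((f ^^ t) (y \<sigma>)) ((f ^^ t) (y \<tau>))"
    if dif: "\<And>m. \<exists>k\<ge>m. \<sigma> k \<noteq> \<tau> k" for \<sigma> \<tau> t
  proof (rule DC1_pairI[where ?d0.0 = "d0 / 3"])
    have shift: "(f ^^ i) ((f ^^ t) z) = (f ^^ (i + t)) z" for i z by (simp add: funpow_add)
    show "(f ^^ t) (y \<sigma>) \<in> X" "(f ^^ t) (y \<tau>) \<in> X" using y(1) funpow_in_X by blast+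
    show "d0 / 3 > 0" using d0(1) by simp
    show "upper_full (\<lambda>i. dist ((f ^^ i) ((f ^^ t) (y \<sigma>))) ((f ^^ i) ((f ^^ t) (y \<tau>))) < d)"
      if "d > 0" for d
    proof -
      have d2: "d / 2 > 0" using that by simp
      obtain m1 where m1: "\<And>i. i \<ge> m1 \<Longrightarrow> dist ((f ^^ i) (y \<sigma>)) (x \<sigma> i) < d / 2" using y_ev[OF d2] by blast
      obtain m2 where m2: "\<And>i. i \<ge> m2 \<Longrightarrow> dist ((f ^^ i) (y \<tau>)) (x \<tau> i) < d / 2" using y_ev[OF d2] by blast
      have "dist ((f ^^ i) (y \<sigma>)) ((f ^^ i) (y \<tau>)) < d" if "i \<ge> max m1 m2" "x \<sigma> i = x \<tau> i" for i
        using m1[of i] m2[of i] that dist_triangle2[of "(f ^^ i) (y \<sigma>)" "(f ^^ i) (y \<tau>)" "x \<sigma> i"] by simp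
      then have "upper_full (\<lambda>i. dist ((f ^^ i) (y \<sigma>)) ((f ^^ i) (y \<tau>)) < d)"
        by (rule upper_full_eventually_mono[OF agree])
      from upper_full_shift[OF this] show ?thesis by (simp add: shift)
    qed
    \<comment> \<open>Two shadowing errors below \<open>d0 / 3\<close> leave more than a third of
      \<open>d0\<close>.\<close>
    have d3: "d0 / 3 > 0" using d0(1) by simp
    obtain m1 where m1: "\<And>i. i \<ge> m1 \<Longrightarrow> dist ((f ^^ i) (y \<sigma>)) (x \<sigma> i) < d0 / 3" using y_ev[OF d3] by blast
    obtain m2 where m2: "\<And>i. i \<ge> m2 \<Longrightarrow> dist ((f ^^ i) (y \<tau>)) (x \<tau> i) < d0 / 3" using y_ev[OF d3] by blast
    have "d0 / 3 < dist ((f ^^ i) (y \<sigma>)) ((f ^^ i) (y \<tau>))"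
      if "i \<ge> max m1 m2" "d0 \<le> dist (x \<sigma> i) (x \<tau> i)" for i
      using m1[of i] m2[of i] that dist_triangle[of "x \<sigma> i" "x \<tau> i" "(f ^^ i) (y \<sigma>)"]
        dist_triangle[of "(f ^^ i) (y \<sigma>)" "x \<tau> i" "(f ^^ i) (y \<tau>)"] by (simp add: dist_commute)
    then have "upper_full (\<lambda>i. d0 / 3 < dist ((f ^^ i) (y \<sigma>)) ((f ^^ i) (y \<tau>)))"
      by (rule upper_full_eventually_mono[OF differ[OF dif]])
    from upper_full_shift[OF this]
    show "upper_full (\<lambda>i. d0 / 3 < dist ((f ^^ i) ((f ^^ t) (y \<sigma>))) ((f ^^ i) ((f ^^ t) (y \<tau>))))"
      by (simp add: shift)
  qed
  have "exhibits_DC1 X f"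
  proof -
    \<comment> \<open>Pairing repeats each membership bit at infinitely many indices, so different
      subsets give codes that differ infinitely often.\<close>
    define \<sigma> where "\<sigma> A k \<longleftrightarrow> fst (prod_decode k) \<in> A" for A :: "nat set" and k
    have dif: "\<exists>k\<ge>m. \<sigma> A k \<noteq> \<sigma> A' k" if AA: "A \<noteq> A'" for A A' m
    proof -
      obtain n where "n \<in> A \<longleftrightarrow> n \<notin> A'" using AA by blast
      then have "\<sigma> A (prod_encode (n, m)) \<noteq> \<sigma> A' (prod_encode (n, m))" by (simp add: \<sigma>_def)
      then show ?thesis using le_prod_encode_2[of m n] by blast
    qed
    have pair: "DC1_pair X f (y (\<sigma> A)) (y (\<sigma> A'))" if "A \<noteq> A'" for A A'
      using DC1[of "\<sigma> A" "\<sigma> A'" 0, OF dif[OF that]] by simp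
    then have "inj (\<lambda>A. y (\<sigma> A))"
      using DC1_pair_irrefl by (metis injI)
    moreover have "uncountable (UNIV :: nat set set)"
    proof
      assume "countable (UNIV :: nat set set)"
      then have "from_nat_into (UNIV :: nat set set) ` UNIV = Pow UNIV"
        using range_from_nat_into[of "UNIV :: nat set set"] by simp
      then show False using Cantors_theorem by blast
    qed
    ultimately have "uncountable (range (\<lambda>A. y (\<sigma> A)))"
      using countable_image_inj_on by blast
    moreover have "DC1_pair X f (y (\<sigma> A)) (y (\<sigma> A'))" if "y (\<sigma> A) \<noteq> y (\<sigma> A')" for A A'
      using that by (intro pair) auto
    ultimately show ?thesis
      unfolding exhibits_DC1_def using y(1)
      by (intro exI[of _ "range (\<lambda>A. y (\<sigma> A))"]) auto
  qed
  moreover have "\<exists>x y. DC1_pair X f x y \<and> dist u x < e0 \<and> dist v y < e0"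
  proof -
    \<comment> \<open>At every index these codes stand in the order that \<open>close\<close> asks
      for.\<close>
    define \<sigma> \<tau> where "\<sigma> = (\<lambda>_::nat. False)" and "\<tau> = (\<lambda>_::nat. True)"
    have e2: "e0 / 2 > 0" using \<open>e0 > 0\<close> by simp
    obtain m1 where m1: "\<And>i. i \<ge> m1 \<Longrightarrow> dist ((f ^^ i) (y \<sigma>)) (x \<sigma> i) < e0 / 2" using y_ev[OF e2] by blast
    obtain m2 where m2: "\<And>i. i \<ge> m2 \<Longrightarrow> dist ((f ^^ i) (y \<tau>)) (x \<tau> i) < e0 / 2" using y_ev[OF e2] by blast
    obtain i where i: "i \<ge> max m1 m2" "near_pair e u v (x \<sigma> i) (x \<tau> i)"
      using close[of \<sigma> \<tau> "max m1 m2"] by (auto simp: \<sigma>_def \<tau>_def)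
    have "dist u ((f ^^ i) (y \<sigma>)) < e0" "dist v ((f ^^ i) (y \<tau>)) < e0"
      using i m1[of i] m2[of i] e(2) dist_triangle[of u "(f ^^ i) (y \<sigma>)" "x \<sigma> i"]
        dist_triangle[of v "(f ^^ i) (y \<tau>)" "x \<tau> i"]
      by (auto simp: near_pair_def dist_commute)
    moreover have "DC1_pair X f ((f ^^ i) (y \<sigma>)) ((f ^^ i) (y \<tau>))"
      by (rule DC1) (auto simp: \<sigma>_def \<tau>_def)
    ultimately show ?thesis by blast
  qed
  ultimately show ?thesis ..
qed

end


section \<open>Positive entropy and DC1\<close>

context covered_system
begin

lemma X_nonempty:
  assumes "cover_entropy X f U > 0"
  shows "X \<noteq> {}"
proof
  assume "X = {}"
  then have "itin_num X 0 = 0" using itin_num_le[of "{}" 0 X] by simp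
  moreover obtain a where "\<And>n. exp (a * real n) \<le> real (itin_num X n)"
    using itin_num_ge_exp[OF assms] by blast
  ultimately show False by (metis exp_gt_zero not_less of_nat_0)
qed

text \<open>\<open>Z\<close> is an abstract relation of being far apart, tied to the cover: a set
  without pairs in \<open>Z\<close> fits into one member of \<open>U\<close>. Each of the two claims
  results from its own choice of \<open>Z\<close>.\<close>

lemma DC1_near_separated_pair:
  assumes "limit_shadowing X f" "cover_entropy X f U > 0" "closed Z" "\<And>u v. (u, v) \<in> Z \<Longrightarrow> u \<noteq> v"
    and Z: "\<And>E. E \<subseteq> X \<Longrightarrow> (\<forall>u\<in>E. \<forall>v\<in>E. (u, v) \<notin> Z) \<Longrightarrow> \<exists>V\<in>U. E \<subseteq> V"
  shows "\<exists>u v. (u, v) \<in> Z \<and> (\<forall>e>0. exhibits_DC1 X f \<and>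
    (\<exists>x y. DC1_pair X f x y \<and> dist u x < e \<and> dist v y < e))"
proof -
  obtain a where a: "a > 0" "\<And>n. exp (a * real n) \<le> real (itin_num X n)"
    using itin_num_ge_exp[OF assms(2)] by blast
  obtain K where K: "minimal_carrier a K" using minimal_carrier_exists[OF a(2)] .
  then have KX: "K \<subseteq> X" by (auto simp: minimal_carrier_def carries_def)
  have ZK: "\<exists>V\<in>U. E \<subseteq> V" if "E \<subseteq> K" "\<forall>u\<in>E. \<forall>v\<in>E. (u, v) \<notin> Z" for E
    using Z[of E] that KX by blast
  obtain u v where uv: "(u, v) \<in> Z" "u \<in> K" "v \<in> K"
    and common: "\<forall>d>0. \<exists>l\<ge>1. chain_to K f d l u u \<and> chain_to K f d l u v \<and>
      chain_to K f d l v u \<and> chain_to K f d l v v"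
    using common_length_pair[OF K a(1) assms(3)] ZK by metis
  have "exhibits_DC1 X f \<and> (\<exists>x y. DC1_pair X f x y \<and> dist u x < e \<and> dist v y < e)" if "e > 0" for e
    by (rule DC1_from_pair[OF assms(1) KX that uv(2,3) assms(4)[OF uv(1)]])
      (use minimal_carrier_transitive[OF K a(1)] common in blast)+
  then show ?thesis using uv(1) by blast
qed

end

section \<open>The separation relation for each of the two claims\<close>

context compact_system
begin

lemma exhibits_DC1_of_entropy:
  assumes "limit_shadowing X f" "open_cover X U" "cover_entropy X f U > 0"
  shows "exhibits_DC1 X f"
proof -
  interpret covered_system X f U by unfold_locales fact
  \<comment> \<open>The Lebesgue number lemma speaks of sets open in the whole space, so
    \<open>U\<close> is replaced by the open sets whose traces belong to it.\<close>
  define C where "C = {G. open G \<and> X \<inter> G \<in> U}"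
  have sub: "X \<subseteq> \<Union>C"
  proof
    fix x assume "x \<in> X"
    then obtain V where V: "V \<in> U" "x \<in> V" "openin (top_of_set X) V"
      using open_cover_U by (auto simp: open_cover_def)
    then obtain G where "open G" "V = X \<inter> G" by (auto simp: openin_open)
    then show "x \<in> \<Union>C" using V by (auto simp: C_def)
  qed
  then have "C \<noteq> {}" using X_nonempty[OF assms(3)] by blast
  then obtain \<delta> where \<delta>: "\<delta> > 0" "\<And>T. T \<subseteq> X \<Longrightarrow> diameter T < \<delta> \<Longrightarrow> \<exists>B\<in>C. T \<subseteq> B"
    by (rule Lebesgue_number_lemma[OF compact_X _ sub]) (auto simp: C_def)
  \<comment> \<open>The value \<open>\<delta> / 2\<close> keeps the diameter of a set without such
    pairs strictly below \<open>\<delta>\<close>.\<close>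
  define Z where "Z = {p :: 'a \<times> 'a. \<delta> / 2 \<le> dist (fst p) (snd p)}"
  have Z: "closed Z" unfolding Z_def by (intro closed_Collect_le continuous_intros)
  have ne: "u \<noteq> v" if "(u, v) \<in> Z" for u v using that \<delta>(1) by (auto simp: Z_def)
  have sep: "\<exists>V\<in>U. E \<subseteq> V" if E: "E \<subseteq> X" "\<forall>u\<in>E. \<forall>v\<in>E. (u, v) \<notin> Z" for E
  proof -
    have "diameter E \<le> \<delta> / 2"
    proof (cases "E = {}")
      case False
      have "dist x y \<le> \<delta> / 2" if "x \<in> E" "y \<in> E" for x y
        using E(2) that by (force simp: Z_def)
      then have "(SUP (x, y)\<in>E \<times> E. dist x y) \<le> \<delta> / 2"
        using False by (intro cSUP_least) auto
      then show ?thesis using False by (simp add: diameter_def)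
    qed (use \<delta>(1) in simp)
    then have "diameter E < \<delta>" using \<delta>(1) by linarith
    then obtain B where "B \<in> C" "E \<subseteq> B" using \<delta>(2)[OF E(1)] by blast
    then show ?thesis using E(1) by (intro bexI[of _ "X \<inter> B"]) (auto simp: C_def)
  qed
  have "\<exists>u v. (u, v) \<in> Z \<and> (\<forall>e>0. exhibits_DC1 X f \<and>
      (\<exists>x y. DC1_pair X f x y \<and> dist u x < e \<and> dist v y < e))"
    by (rule DC1_near_separated_pair[OF assms(1,3) Z]) (fact ne sep)+
  then show ?thesis by (meson zero_less_one)
qed

lemma entropy_pairs_subset_closure:
  assumes "limit_shadowing X f"
  shows "entropy_pairs X f \<subseteq> closure (DC1_pairs X f)"
proof
  fix z assume "z \<in> entropy_pairs X f"
  then obtain p q where pq: "z = (p, q)" "p \<in> X" "q \<in> X" "p \<noteq> q"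
    "\<And>A B. closed_nbhd X A p \<Longrightarrow> closed_nbhd X B q \<Longrightarrow> A \<inter> B = {} \<Longrightarrow>
      cover_entropy X f {X - A, X - B} > 0"
    by (auto simp: entropy_pairs_def)
  have "\<exists>w\<in>DC1_pairs X f. dist w z < e" if "e > 0" for e
  proof -
    \<comment> \<open>A third of the distance makes the balls disjoint; \<open>e / 4\<close>, added
      to the distance of the DC1 pair from \<open>(u, v)\<close>, stays below \<open>e / 2\<close>
      in each coordinate.\<close>
    define r where "r = min (e / 4) (dist p q / 3)"
    have r: "r > 0" "r \<le> e / 4" "3 * r \<le> dist p q" using \<open>e > 0\<close> pq(4) by (auto simp: r_def)
    define A where "A = X \<inter> cball p r"
    define B where "B = X \<inter> cball q r"
    have nbhd: "closed_nbhd X (X \<inter> cball x r) x" if "x \<in> X" for x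
      unfolding closed_nbhd_def
    proof
      show "closedin (top_of_set X) (X \<inter> cball x r)" by (simp add: closedin_closed_Int)
      have "openin (top_of_set X) (X \<inter> ball x r)" by (simp add: openin_open_Int)
      then show "\<exists>V. openin (top_of_set X) V \<and> x \<in> V \<and> V \<subseteq> X \<inter> cball x r"
        using that r(1) by (intro exI[of _ "X \<inter> ball x r"]) auto
    qed
    have disj: "cball p r \<inter> cball q r = {}"
    proof -
      have False if "dist p x \<le> r" "dist q x \<le> r" for x
        using dist_triangle[of p q x] that r(1,3) by (simp add: dist_commute)
      then show ?thesis by fastforce
    qed
    define U where "U = {X - A, X - B}"
    have ent: "cover_entropy X f U > 0"
      unfolding U_def using nbhd pq(2,3) disj by (intro pq(5)) (auto simp: A_def B_def)
    have "openin (top_of_set X) (X - A)" "openin (top_of_set X) (X - B)"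
      by (auto simp: A_def B_def intro!: openin_diff closedin_closed_Int)
    moreover have "X \<subseteq> (X - A) \<union> (X - B)" using disj by (auto simp: A_def B_def)
    ultimately have "open_cover X U" by (auto simp: open_cover_def U_def)
    then interpret covered_system X f U by unfold_locales
    \<comment> \<open>A set without pairs in this product misses one of the two balls, hence lies in
      a member of \<open>U\<close>.\<close>
    define Z where "Z = cball p r \<times> cball q r"
    have Z: "closed Z" unfolding Z_def by (intro closed_Times closed_cball)
    have ne: "u \<noteq> v" if "(u, v) \<in> Z" for u v using that disj by (auto simp: Z_def)
    have sep: "\<exists>V\<in>U. E \<subseteq> V" if "E \<subseteq> X" "\<forall>u\<in>E. \<forall>v\<in>E. (u, v) \<notin> Z" for E
    proof (cases "E \<inter> cball p r = {}")
      case True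
      then have "E \<subseteq> X - A" using that(1) by (auto simp: A_def)
      then show ?thesis by (auto simp: U_def)
    next
      case False
      then have "E \<inter> cball q r = {}" using that(2) unfolding Z_def by blast
      then have "E \<subseteq> X - B" using that(1) by (auto simp: B_def)
      then show ?thesis by (auto simp: U_def)
    qed
    have "\<exists>u v. (u, v) \<in> Z \<and> (\<forall>e>0. exhibits_DC1 X f \<and>
        (\<exists>x y. DC1_pair X f x y \<and> dist u x < e \<and> dist v y < e))"
      by (rule DC1_near_separated_pair[OF assms ent Z]) (fact ne sep)+
    then obtain u v where uv: "(u, v) \<in> Z" "\<forall>e>0. exhibits_DC1 X f \<and>
        (\<exists>x y. DC1_pair X f x y \<and> dist u x < e \<and> dist v y < e)"
      by blast
    have "e / 4 > 0" using \<open>e > 0\<close> by simp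
    then obtain x y where xy: "DC1_pair X f x y" "dist u x < e / 4" "dist v y < e / 4"
      using uv(2) by blast
    have "dist p u \<le> e / 4" "dist q v \<le> e / 4" using uv(1) r(2) by (auto simp: Z_def)
    then have "dist x p < e / 2" "dist y q < e / 2"
      using xy dist_triangle[of p x u] dist_triangle[of q y v] by (simp_all add: dist_commute)
    moreover have "dist (x, y) (p, q) \<le> dist x p + dist y q"
      unfolding dist_Pair_Pair by (rule sqrt_sum_squares_le_sum) auto
    ultimately show ?thesis
      using xy(1) pq(1) by (intro bexI[of _ "(x, y)"]) (auto simp: DC1_pairs_def)
  qed
  then show "z \<in> closure (DC1_pairs X f)" by (simp add: closure_approachable)
qed

end

theorem theorem1p2:
  fixes X :: "'a::metric_space set" and f :: "'a \<Rightarrow> 'a"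
  assumes "compact X"
    and "continuous_on X f" and "f ` X \<subseteq> X"
    and "limit_shadowing X f"
    and "top_entropy X f > 0"
  shows "exhibits_DC1 X f \<and> entropy_pairs X f \<subseteq> closure (DC1_pairs X f)"
proof
  interpret compact_system X f by unfold_locales fact+
  obtain U where "open_cover X U" "ereal (cover_entropy X f U) > 0"
    using assms(5) unfolding top_entropy_def less_SUP_iff by blast
  then show "exhibits_DC1 X f" using exhibits_DC1_of_entropy[OF assms(4)] by simp
  show "entropy_pairs X f \<subseteq> closure (DC1_pairs X f)"
    using entropy_pairs_subset_closure[OF assms(4)] .
qed

end
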